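(* Let $n\ge 1$, let $A \in \mathbb{R}^{n\times n}$ be any matrix, let $\epsilon>0$, and let $\widetilde A$ be the output of the sparsification procedure described in the context, run with the number of samples $$s = \frac{28\, n \ln\left(\sqrt{2}\,n\right)}{\epsilon^{2}}\,\|A\|_F^2 .$$ Then, with probability at least $1-n^{-1}$, $$\|A-\widetilde A\|_2 \le \epsilon .$$ Moreover, $\widetilde A$ has at most $s$ non-zero entries, and the construction of $\widetilde A$ can be implemented in one pass over the entries of $A$.
   Context: Sparsification procedure (input $A\in\mathbb{R}^{n\times n}$, accuracy $\epsilon>0$, number of samples $s$): (1) Let $\widehat A$ be the matrix obtained from $A$ by setting to zero every entry $A_{ij}$ with $|A_{ij}|<\epsilon/(2n)$, keeping all other entries unchanged. (2) If $\widehat A\neq 0$, perform $s$ independent, identically distributed trials (with replacement); in trial $t$ pick an index pair $(i_t,j_t)\in[n]\times[n]$ with $\mathbb{P}((i_t,j_t)=(i,j))=p_{ij}:=\widehat A_{ij}^2/\|\widehat A\|_F^2$. (3) Output $$\widetilde A=\frac1s\sum_{t=1}^s \frac{\widehat A_{i_tj_t}}{p_{i_tj_t}}\, e_{i_t}e_{j_t}^T,$$ where $e_1,\dots,e_n$ are the standard basis vectors of $\mathbb{R}^n$. If $\widehat A=0$, the output is $\widetilde A=0$. Here $\|\cdot\|_2$ denotes the spectral (operator) norm and $\|\cdot\|_F$ the Frobenius norm; $\ln$ is the natural logarithm. *)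

theory Defs
  imports "HOL-Probability.Probability"
begin

definition frobenius_norm :: "real ^ 'n ^ 'm \<Rightarrow> real" where
  "frobenius_norm A = sqrt (\<Sum>i\<in>UNIV. \<Sum>j\<in>UNIV. (A $ i $ j)\<^sup>2)"

definition spectral_norm :: "real ^ 'n ^ 'm \<Rightarrow> real" where
  "spectral_norm A = onorm (\<lambda>x. A *v x)"

definition truncate_entries :: "real \<Rightarrow> real ^ 'n ^ 'n \<Rightarrow> real ^ 'n ^ 'n" where
  "truncate_entries \<epsilon> A =
     (\<chi> i j. if \<bar>A $ i $ j\<bar> < \<epsilon> / (2 * real CARD('n)) then 0 else A $ i $ j)"

definition matrix_unit :: "'n \<Rightarrow> 'n \<Rightarrow> real ^ 'n ^ 'n" where
  "matrix_unit i j = (columnvector (axis i 1) :: real ^ 1 ^ 'n) ** rowvector (axis j 1)"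

definition entry_prob :: "real ^ 'n ^ 'n \<Rightarrow> 'n \<times> 'n \<Rightarrow> real" where
  "entry_prob B = (\<lambda>(i, j). (B $ i $ j)\<^sup>2 / (frobenius_norm B)\<^sup>2)"

text \<open>Only meaningful for \<open>B \<noteq> 0\<close>, where the values of \<open>entry_prob B\<close> sum to 1.\<close>

definition entry_pmf :: "real ^ 'n ^ 'n \<Rightarrow> ('n \<times> 'n) pmf" where
  "entry_pmf B = embed_pmf (entry_prob B)"

definition sample_average ::
    "nat \<Rightarrow> real ^ 'n ^ 'n \<Rightarrow> (nat \<Rightarrow> 'n \<times> 'n) \<Rightarrow> real ^ 'n ^ 'n" where
  "sample_average s B \<omega> =
     (1 / real s) *\<^sub>R
       (\<Sum>t<s. case \<omega> t of (i, j) \<Rightarrow> (B $ i $ j / entry_prob B (i, j)) *\<^sub>R matrix_unit i j)"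

text \<open>The random output is represented by its distribution.\<close>

definition sparsify :: "real \<Rightarrow> nat \<Rightarrow> real ^ 'n ^ 'n \<Rightarrow> (real ^ 'n ^ 'n) pmf" where
  "sparsify \<epsilon> s A =
     (let B = truncate_entries \<epsilon> A
      in if B = 0 then return_pmf 0
         else map_pmf (sample_average s B) (Pi_pmf {..<s} undefined (\<lambda>_. entry_pmf B)))"

definition nonzero_entries :: "real ^ 'n ^ 'm \<Rightarrow> ('m \<times> 'n) set" where
  "nonzero_entries A = {(i, j). A $ i $ j \<noteq> 0}"


text \<open>
  A one-pass computation reads every entry of the input matrix exactly once, in an arbitrary order,
  and can afterwards only use what it has kept in its working memory. The notion has content only
  if the memory cannot hold the whole matrix. We count real registers and position cells (one
  position is a row index and a column index, so two words). Counting reals is meaningless if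
  arbitrary functions may act on them, since one real can encode a matrix; hence the
  step executed for each entry is a program whose only operations are field arithmetic,
  comparisons, coin flips, and storing the current entry and its position.
\<close>

datatype rexp =
    Const real
  | Reg nat
  | Plus rexp rexp
  | Minus rexp rexp
  | Times rexp rexp
  | Divide rexp rexp

primrec rexp_val :: "rexp \<Rightarrow> (nat \<Rightarrow> real) \<Rightarrow> real" where
  "rexp_val (Const c) \<rho> = c"
| "rexp_val (Reg k) \<rho> = \<rho> k"
| "rexp_val (Plus a b) \<rho> = rexp_val a \<rho> + rexp_val b \<rho>"
| "rexp_val (Minus a b) \<rho> = rexp_val a \<rho> - rexp_val b \<rho>"
| "rexp_val (Times a b) \<rho> = rexp_val a \<rho> * rexp_val b \<rho>"
| "rexp_val (Divide a b) \<rho> = rexp_val a \<rho> / rexp_val b \<rho>"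

datatype prog =
    Skip
  | Load_Value nat
  | Load_Position nat
  | Assign nat rexp
  | Seq prog prog
  | If_Less rexp rexp prog prog
  | Flip rexp prog prog

type_synonym 'n memory = "(nat \<Rightarrow> real) \<times> (nat \<Rightarrow> ('n \<times> 'n) option)"

text \<open>\<open>bernoulli_pmf\<close> clamps its argument to the unit interval.\<close>

primrec exec :: "prog \<Rightarrow> 'n \<times> 'n \<Rightarrow> real \<Rightarrow> 'n memory \<Rightarrow> 'n memory pmf" where
  "exec Skip ij a \<sigma> = return_pmf \<sigma>"
| "exec (Load_Value k) ij a \<sigma> = return_pmf ((fst \<sigma>)(k := a), snd \<sigma>)"
| "exec (Load_Position k) ij a \<sigma> = return_pmf (fst \<sigma>, (snd \<sigma>)(k := Some ij))"
| "exec (Assign k e) ij a \<sigma> = return_pmf ((fst \<sigma>)(k := rexp_val e (fst \<sigma>)), snd \<sigma>)"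
| "exec (Seq p q) ij a \<sigma> = bind_pmf (exec p ij a \<sigma>) (exec q ij a)"
| "exec (If_Less d e p q) ij a \<sigma> =
     (if rexp_val d (fst \<sigma>) < rexp_val e (fst \<sigma>) then exec p ij a \<sigma> else exec q ij a \<sigma>)"
| "exec (Flip e p q) ij a \<sigma> =
     bind_pmf (bernoulli_pmf (rexp_val e (fst \<sigma>)))
       (\<lambda>b. if b then exec p ij a \<sigma> else exec q ij a \<sigma>)"

text \<open>Cells that are never written keep their initial value, so only written cells are counted.\<close>

primrec written_regs :: "prog \<Rightarrow> nat set" where
  "written_regs Skip = {}"
| "written_regs (Load_Value k) = {k}"
| "written_regs (Load_Position k) = {}"
| "written_regs (Assign k e) = {k}"
| "written_regs (Seq p q) = written_regs p \<union> written_regs q"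
| "written_regs (If_Less d e p q) = written_regs p \<union> written_regs q"
| "written_regs (Flip e p q) = written_regs p \<union> written_regs q"

primrec written_positions :: "prog \<Rightarrow> nat set" where
  "written_positions Skip = {}"
| "written_positions (Load_Value k) = {}"
| "written_positions (Load_Position k) = {k}"
| "written_positions (Assign k e) = {}"
| "written_positions (Seq p q) = written_positions p \<union> written_positions q"
| "written_positions (If_Less d e p q) = written_positions p \<union> written_positions q"
| "written_positions (Flip e p q) = written_positions p \<union> written_positions q"

definition memory_words :: "prog \<Rightarrow> nat" where
  "memory_words p = card (written_regs p) + 2 * card (written_positions p)"

primrec run_stream ::
    "prog \<Rightarrow> real ^ 'n ^ 'n \<Rightarrow> ('n \<times> 'n) list \<Rightarrow> 'n memory \<Rightarrow> 'n memory pmf" where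
  "run_stream p A [] \<sigma> = return_pmf \<sigma>"
| "run_stream p A (ij # ijs) \<sigma> =
     bind_pmf (exec p ij (A $ fst ij $ snd ij) \<sigma>) (run_stream p A ijs)"

text \<open>The result is read off the final memory as a list of (position, value) pairs, values at equal
  positions being added up; unset position cells are ignored.\<close>

definition read_off :: "(nat \<times> rexp) list \<Rightarrow> 'n memory \<Rightarrow> real ^ 'n ^ 'n" where
  "read_off out \<sigma> =
     (\<Sum>(k, e) \<leftarrow> out. case snd \<sigma> k of
        None \<Rightarrow> 0
      | Some (i, j) \<Rightarrow> rexp_val e (fst \<sigma>) *\<^sub>R matrix_unit i j)"

text \<open>The program is chosen before the input matrix and the order of its entries.\<close>

definition one_pass_implementable ::
    "nat \<Rightarrow> (real ^ 'n ^ 'n \<Rightarrow> (real ^ 'n ^ 'n) pmf) \<Rightarrow> bool" where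
  "one_pass_implementable m K \<longleftrightarrow>
     (\<exists>p out. memory_words p \<le> m \<and>
        (\<forall>A ijs. distinct ijs \<and> set ijs = UNIV \<longrightarrow>
           map_pmf (read_off out) (run_stream p A ijs (\<lambda>_. 0, \<lambda>_. None)) = K A))"

end

theory Submission
  imports Defs
begin

text \<open>
  Truncation changes \<open>A\<close> by at most \<open>\<epsilon>/2\<close> in Frobenius norm; the other \<open>\<epsilon>/2\<close> is the sampling error, bounded by a
  matrix Bernstein inequality applied to the self-adjoint dilations of the centred samples, whose
  variance is at most \<open>n \<parallel>B\<parallel>\<^sub>F\<^sup>2\<close> and whose norm is at most \<open>4 n \<parallel>B\<parallel>\<^sub>F\<^sup>2 / \<epsilon>\<close>, where \<open>B\<close> is the truncated matrix.

  The Bernstein inequality follows the Ahlswede--Winter argument, but with \<open>(1 + S/N)\<^sup>N\<close>, \<open>N = 2\<^sup>k\<close>, in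
  place of the matrix exponential. The Golden--Thompson inequality is then replaced by
  \<open>tr (P Q)\<^sup>N \<le> tr (P\<^sup>N Q\<^sup>N)\<close> for symmetric \<open>P\<close>, \<open>Q\<close>, which needs nothing but the Cauchy--Schwarz inequality
  for the Hilbert--Schmidt inner product; the errors of order \<open>1/N\<close> vanish as \<open>k \<rightarrow> \<infinity>\<close>, and no spectral
  theorem is used.

  The one-pass algorithm runs \<open>s\<close> independent reservoir samplers that share one running sum of squares:
  a kept entry \<open>a\<close> replaces the content of each cell with probability \<open>a\<^sup>2\<close> divided by the sum so far.
\<close>

subsection \<open>Spectral norm and trace\<close>

lemma norm_mult_spectral_norm: "norm (A *v x) \<le> spectral_norm A * norm x"
  for A :: "real ^ 'n ^ 'm"
  unfolding spectral_norm_def by (rule onorm) (rule matrix_vector_mul_bounded_linear)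

lemma spectral_norm_le: "(\<And>x. norm (A *v x) \<le> c * norm x) \<Longrightarrow> spectral_norm A \<le> c"
  for A :: "real ^ 'n ^ 'm"
  unfolding spectral_norm_def by (rule onorm_le)

lemma spectral_norm_nonneg: "0 \<le> spectral_norm A" for A :: "real ^ 'n ^ 'm"
  unfolding spectral_norm_def by (rule onorm_pos_le) (rule matrix_vector_mul_bounded_linear)

lemma spectral_norm_triangle: "spectral_norm (A + B) \<le> spectral_norm A + spectral_norm B"
  for A B :: "real ^ 'n ^ 'm"
proof (rule spectral_norm_le)
  fix x :: "real ^ 'n"
  have "norm ((A + B) *v x) \<le> norm (A *v x) + norm (B *v x)"
    by (simp add: matrix_vector_mult_add_rdistrib norm_triangle_ineq)
  also have "\<dots> \<le> (spectral_norm A + spectral_norm B) * norm x"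
    using norm_mult_spectral_norm[of A x] norm_mult_spectral_norm[of B x]
    by (simp add: distrib_right)
  finally show "norm ((A + B) *v x) \<le> (spectral_norm A + spectral_norm B) * norm x" .
qed

lemma spectral_norm_mult: "spectral_norm (A ** B) \<le> spectral_norm A * spectral_norm B"
  for A :: "real ^ 'n ^ 'm" and B :: "real ^ 'k ^ 'n"
proof (rule spectral_norm_le)
  fix x :: "real ^ 'k"
  have "norm ((A ** B) *v x) \<le> spectral_norm A * norm (B *v x)"
    using norm_mult_spectral_norm[of A "B *v x"] by (simp add: matrix_vector_mul_assoc)
  also have "\<dots> \<le> spectral_norm A * (spectral_norm B * norm x)"
    by (intro mult_left_mono norm_mult_spectral_norm spectral_norm_nonneg)
  finally show "norm ((A ** B) *v x) \<le> spectral_norm A * spectral_norm B * norm x"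
    by (simp add: mult.assoc)
qed

lemma spectral_norm_scaleR: "spectral_norm (c *\<^sub>R A) = \<bar>c\<bar> * spectral_norm A"
  for A :: "real ^ 'n ^ 'm"
  unfolding spectral_norm_def
  using onorm_scaleR[OF matrix_vector_mul_bounded_linear[of A], of c]
  by (simp add: scaleR_matrix_vector_assoc)

lemma spectral_norm_mat_1: "spectral_norm (mat 1 :: real ^ 'n ^ 'n) \<le> 1"
  by (rule spectral_norm_le) simp

lemma norm_matrix: "norm A = frobenius_norm A" for A :: "real ^ 'n ^ 'm"
  by (simp add: frobenius_norm_def norm_vec_def L2_set_def sum_nonneg)

text \<open>Cauchy--Schwarz in each row, then summation of the squares over the rows.\<close>

lemma spectral_norm_le_norm: "spectral_norm A \<le> norm A" for A :: "real ^ 'n ^ 'm"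
proof (rule spectral_norm_le)
  fix x :: "real ^ 'n"
  have "(norm (A *v x))\<^sup>2 = (\<Sum>i\<in>UNIV. (A $ i \<bullet> x)\<^sup>2)"
    by (simp add: norm_vec_def L2_set_def sum_nonneg matrix_vector_mul_component)
  also have "\<dots> \<le> (\<Sum>i\<in>UNIV. (norm (A $ i))\<^sup>2 * (norm x)\<^sup>2)"
    by (intro sum_mono) (metis Cauchy_Schwarz_ineq2 abs_ge_zero power2_abs power_mono power_mult_distrib)
  also have "\<dots> = (norm A * norm x)\<^sup>2"
    by (simp add: sum_distrib_right[symmetric] power_mult_distrib norm_vec_def[of A] L2_set_def sum_nonneg)
  finally show "norm (A *v x) \<le> norm A * norm x"
    by (rule power2_le_imp_le) simp
qed

text \<open>The inner product of the matrix type is the entrywise one, that is, the Hilbert--Schmidt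
  product. Cauchy--Schwarz for it thereby becomes an inequality about traces.\<close>

lemma trace_mult_transpose: "trace (A ** transpose B) = A \<bullet> B" for A B :: "real ^ 'n ^ 'm"
  by (simp add: trace_def matrix_matrix_mult_def transpose_def inner_vec_def)

lemma trace_mult_transpose_self: "trace (A ** transpose A) = (norm A)\<^sup>2" for A :: "real ^ 'n ^ 'm"
  by (simp add: trace_mult_transpose power2_norm_eq_inner)

lemma norm_transpose: "norm (transpose A) = norm A" for A :: "real ^ 'n ^ 'm"
proof -
  have "(norm (transpose A))\<^sup>2 = (norm A)\<^sup>2"
    by (metis trace_mult_transpose_self trace_mul_sym transpose_transpose)
  then show ?thesis by simp
qed

lemma trace_mult_le_norm: "\<bar>trace (A ** B)\<bar> \<le> norm A * norm B" for A B :: "real ^ 'n ^ 'n"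
proof -
  have "trace (A ** B) = A \<bullet> transpose B"
    by (metis trace_mult_transpose transpose_transpose)
  then show ?thesis by (metis Cauchy_Schwarz_ineq2 norm_transpose)
qed

text \<open>A diagonal entry is a coordinate of the image of a unit vector.\<close>

lemma trace_le_spectral_norm: "\<bar>trace A\<bar> \<le> real CARD('n) * spectral_norm A" for A :: "real ^ 'n ^ 'n"
proof -
  have "\<bar>A $ i $ i\<bar> \<le> spectral_norm A" for i
  proof -
    have "A $ i $ i = (A *v axis i 1) $ i"
      by (simp add: matrix_vector_mult_basis column_def)
    then show ?thesis
      using component_le_norm_cart[of "A *v axis i 1" i] norm_mult_spectral_norm[of A "axis i 1"]
      by simp
  qed
  then have "(\<Sum>i\<in>UNIV. \<bar>A $ i $ i\<bar>) \<le> real CARD('n) * spectral_norm A"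
    by (metis (no_types, lifting) sum_bounded_above)
  then show ?thesis
    unfolding trace_def using sum_abs[of "\<lambda>i. A $ i $ i" UNIV] by linarith
qed

section \<open>Algebra of matrix products and transposes\<close>

lemma inner_symmetric_matrix: "transpose A = A \<Longrightarrow> x \<bullet> (A *v y) = (A *v x) \<bullet> y"
  for A :: "real ^ 'n ^ 'n"
  by (metis dot_lmul_matrix vector_transpose_matrix)

lemma matrix_mult_diff_ldistrib: "A ** (B - C) = A ** B - A ** C"
  for A :: "real ^ 'n ^ 'm" and B C :: "real ^ 'k ^ 'n"
  by (simp add: matrix_eq matrix_vector_mul_assoc[symmetric] matrix_vector_mult_diff_rdistrib
      matrix_vector_mult_diff_distrib)

lemma matrix_mult_diff_rdistrib: "(B - C) ** A = B ** A - C ** A"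
  for A :: "real ^ 'n ^ 'm" and B C :: "real ^ 'm ^ 'k"
  by (simp add: matrix_eq matrix_vector_mul_assoc[symmetric] matrix_vector_mult_diff_rdistrib)

lemma matrix_mult_add_rdistrib: "(B + C) ** A = B ** A + C ** A"
  for A :: "real ^ 'n ^ 'm" and B C :: "real ^ 'm ^ 'k"
  by (simp add: matrix_eq matrix_vector_mul_assoc[symmetric] matrix_vector_mult_add_rdistrib)

lemma matrix_mult_scaleR_left: "(c *\<^sub>R A) ** B = c *\<^sub>R (A ** B)"
  for A :: "real ^ 'n ^ 'm" and B :: "real ^ 'k ^ 'n"
  by (simp add: vec_eq_iff matrix_matrix_mult_def sum_distrib_left mult.assoc)

lemma matrix_mult_scaleR_right: "A ** (c *\<^sub>R B) = c *\<^sub>R (A ** B)"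
  for A :: "real ^ 'n ^ 'm" and B :: "real ^ 'k ^ 'n"
  by (simp add: vec_eq_iff matrix_matrix_mult_def sum_distrib_left mult.left_commute)

lemma transpose_add: "transpose (A + B) = transpose A + transpose B" for A B :: "real ^ 'n ^ 'm"
  by (simp add: transpose_def vec_eq_iff)

lemma transpose_sum: "transpose (\<Sum>i\<in>I. f i) = (\<Sum>i\<in>I. transpose (f i))"
  for f :: "'i \<Rightarrow> real ^ 'n ^ 'm"
  by (simp add: transpose_def vec_eq_iff)

subsection \<open>Matrix powers\<close>

primrec mat_pow :: "real ^ 'n ^ 'n \<Rightarrow> nat \<Rightarrow> real ^ 'n ^ 'n" where
  "mat_pow A 0 = mat 1"
| "mat_pow A (Suc k) = A ** mat_pow A k"

lemma mat_pow_add: "mat_pow A (j + k) = mat_pow A j ** mat_pow A k"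
  by (induction j) (simp_all add: matrix_mul_assoc)

lemma mat_pow_Suc_right: "mat_pow A (Suc k) = mat_pow A k ** A"
  using mat_pow_add[of A k 1] by simp

lemma mat_pow_double: "mat_pow A (2 * k) = mat_pow (A ** A) k"
  by (induction k) (simp_all add: matrix_mul_assoc)

lemma mat_pow_2_Suc: "mat_pow A (2 ^ Suc k) = mat_pow (A ** A) (2 ^ k)"
  using mat_pow_double[of A "2 ^ k"] by simp

lemma transpose_mat_pow: "transpose (mat_pow A k) = mat_pow (transpose A) k"
proof (induction k)
  case (Suc k)
  then show ?case
    by (simp only: mat_pow_Suc_right[of A] matrix_transpose_mul mat_pow.simps(2)[of "transpose A"])
qed (simp add: transpose_mat)

text \<open>Shifts the brackets in the word A B A B ... A B by one letter. With the cyclicity of the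
  trace this allows factors to be rotated inside \<open>trace (mat_pow _ k)\<close>.\<close>

lemma mat_pow_mult_swap: "mat_pow (A ** B) (Suc k) = A ** mat_pow (B ** A) k ** B"
proof (induction k)
  case (Suc k)
  have "mat_pow (A ** B) (Suc (Suc k)) = (A ** B) ** (A ** mat_pow (B ** A) k ** B)"
    using Suc by simp
  also have "\<dots> = A ** mat_pow (B ** A) (Suc k) ** B"
    by (simp add: matrix_mul_assoc)
  finally show ?case .
qed simp

lemma trace_mat_pow_swap: "trace (mat_pow (A ** B) k) = trace (mat_pow (B ** A) k)"
  for A B :: "real ^ 'n ^ 'n"
proof (cases k)
  case (Suc j)
  have "trace (mat_pow (A ** B) (Suc j)) = trace (A ** (mat_pow (B ** A) j ** B))"
    by (simp only: mat_pow_mult_swap matrix_mul_assoc)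
  also have "\<dots> = trace (mat_pow (B ** A) (Suc j))"
    by (subst trace_mul_sym) (simp only: mat_pow_Suc_right matrix_mul_assoc)
  finally show ?thesis by (simp only: Suc)
qed simp

text \<open>A power of a symmetric matrix is symmetric, so A^(2k) is A^k times its own transpose.
  Even trace powers are thus squared Frobenius norms, in particular nonnegative.\<close>

lemma trace_mat_pow_double:
  assumes "transpose A = A"
  shows "trace (mat_pow A (2 * k)) = (norm (mat_pow A k))\<^sup>2"
  by (metis assms mat_pow_add mult_2 trace_mult_transpose_self transpose_mat_pow)

text \<open>The two inequalities need a joint induction: at level \<open>k\<close> both of them enter the first one at
  level \<open>k + 1\<close>, through \<open>M\<^sup>2 (M\<^sup>2)\<^sup>T\<close> having the trace powers of \<open>(M M\<^sup>T) (M\<^sup>T M)\<close>, and likewise for the second.\<close>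

lemma trace_mat_pow_inequalities:
  "(\<forall>M :: real ^ 'n ^ 'n. \<bar>trace (mat_pow M (2 ^ Suc k))\<bar> \<le> trace (mat_pow (M ** transpose M) (2 ^ k))) \<and>
   (\<forall>P Q :: real ^ 'n ^ 'n. transpose P = P \<longrightarrow> transpose Q = Q \<longrightarrow>
      trace (mat_pow (P ** Q) (2 ^ k)) \<le> trace (mat_pow P (2 ^ k) ** mat_pow Q (2 ^ k)))"
proof (induction k)
  case 0
  have "\<bar>trace (M ** M)\<bar> \<le> norm M * norm M" for M :: "real ^ 'n ^ 'n"
    by (rule trace_mult_le_norm)
  then show ?case by (simp add: trace_mult_transpose_self power2_eq_square numeral_2_eq_2)
next
  case (Suc k)
  then have IH1: "\<bar>trace (mat_pow M (2 ^ Suc k))\<bar> \<le> trace (mat_pow (M ** transpose M) (2 ^ k))"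
    and IH2: "transpose P = P \<Longrightarrow> transpose Q = Q \<Longrightarrow>
      trace (mat_pow (P ** Q) (2 ^ k)) \<le> trace (mat_pow P (2 ^ k) ** mat_pow Q (2 ^ k))"
    for M P Q :: "real ^ 'n ^ 'n"
    by blast+
  show ?case
  proof (intro conjI allI impI)
    fix M :: "real ^ 'n ^ 'n"
    let ?P = "transpose M ** M" and ?Q = "M ** transpose M"
    have sym: "transpose ?P = ?P" "transpose ?Q = ?Q"
      by (simp_all add: matrix_transpose_mul)
    have "\<bar>trace (mat_pow M (2 ^ Suc (Suc k)))\<bar> \<le> trace (mat_pow ((M ** M) ** transpose (M ** M)) (2 ^ k))"
      using IH1[of "M ** M"] by (simp only: mat_pow_2_Suc[of M])
    \<comment> \<open>Rotating the leading M to the end turns M M M^T M^T into (M M^T) (M^T M), a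
      product of two symmetric matrices, to which the second inequality applies.\<close>
    also have "\<dots> = trace (mat_pow (M ** (?Q ** transpose M)) (2 ^ k))"
      by (simp add: matrix_transpose_mul matrix_mul_assoc)
    also have "\<dots> = trace (mat_pow (?Q ** ?P) (2 ^ k))"
      by (subst trace_mat_pow_swap) (simp only: matrix_mul_assoc)
    also have "\<dots> \<le> trace (mat_pow ?Q (2 ^ k) ** mat_pow ?P (2 ^ k))"
      by (rule IH2[OF sym(2,1)])
    also have "\<dots> \<le> norm (mat_pow ?Q (2 ^ k)) * norm (mat_pow ?P (2 ^ k))"
      using trace_mult_le_norm abs_le_D1 by blast
    \<comment> \<open>The squared norms are trace powers of M^T M and of M M^T, which agree by
      rotation.\<close>
    also have "norm (mat_pow ?P (2 ^ k)) = norm (mat_pow ?Q (2 ^ k))"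
    proof -
      have "(norm (mat_pow ?P (2 ^ k)))\<^sup>2 = (norm (mat_pow ?Q (2 ^ k)))\<^sup>2"
        by (simp only: trace_mat_pow_double[symmetric] sym)
          (rule trace_mat_pow_swap)
      then show ?thesis by simp
    qed
    also have "norm (mat_pow ?Q (2 ^ k)) * norm (mat_pow ?Q (2 ^ k)) = trace (mat_pow ?Q (2 ^ Suc k))"
      by (simp add: trace_mat_pow_double sym power2_eq_square)
    finally show "\<bar>trace (mat_pow M (2 ^ Suc (Suc k)))\<bar> \<le> trace (mat_pow ?Q (2 ^ Suc k))" .
  next
    fix P Q :: "real ^ 'n ^ 'n"
    assume sym: "transpose P = P" "transpose Q = Q"
    have "trace (mat_pow (P ** Q) (2 ^ Suc k)) \<le> trace (mat_pow ((P ** Q) ** transpose (P ** Q)) (2 ^ k))"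
      using IH1[of "P ** Q"] by linarith
    \<comment> \<open>Rotation brings the two copies of P together and leaves a product of the
      symmetric matrices P^2 and Q^2, to which the second inequality at level \<open>k\<close>
      applies.\<close>
    also have "\<dots> = trace (mat_pow (P ** (Q ** Q ** P)) (2 ^ k))"
      by (simp add: matrix_transpose_mul sym matrix_mul_assoc)
    also have "\<dots> = trace (mat_pow ((Q ** Q) ** (P ** P)) (2 ^ k))"
      by (subst trace_mat_pow_swap) (simp add: matrix_mul_assoc)
    also have "\<dots> = trace (mat_pow ((P ** P) ** (Q ** Q)) (2 ^ k))"
      by (rule trace_mat_pow_swap)
    also have "\<dots> \<le> trace (mat_pow (P ** P) (2 ^ k) ** mat_pow (Q ** Q) (2 ^ k))"
      by (rule IH2) (simp_all add: matrix_transpose_mul sym)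
    finally show "trace (mat_pow (P ** Q) (2 ^ Suc k)) \<le> trace (mat_pow P (2 ^ Suc k) ** mat_pow Q (2 ^ Suc k))"
      by (simp only: mat_pow_2_Suc)
  qed
qed

lemma trace_mat_pow_mult_le:
  fixes P Q :: "real ^ 'n ^ 'n"
  assumes "transpose P = P" "transpose Q = Q"
  shows "trace (mat_pow (P ** Q) (2 ^ k)) \<le> trace (mat_pow P (2 ^ k) ** mat_pow Q (2 ^ k))"
  using trace_mat_pow_inequalities[of k] assms by blast

lemma spectral_norm_mat_pow:
  assumes "spectral_norm A \<le> c"
  shows "spectral_norm (mat_pow A k) \<le> c ^ k"
proof (induction k)
  case (Suc k)
  have "spectral_norm (mat_pow A (Suc k)) \<le> spectral_norm A * spectral_norm (mat_pow A k)"
    by (simp add: spectral_norm_mult)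
  also have "\<dots> \<le> c * c ^ k"
    by (intro mult_mono Suc assms spectral_norm_nonneg) (meson assms order_trans spectral_norm_nonneg)
  finally show ?case by simp
qed (simp add: spectral_norm_mat_1)

text \<open>Telescoping: A^(k+1) - B^(k+1) = A (A^k - B^k) + (A - B) B^k. By
  \<open>1 \<le> c\<close> the natural factor c^(k-1) may be replaced by c^k, which avoids a
  subtraction in the exponent.\<close>

lemma spectral_norm_mat_pow_diff:
  assumes "spectral_norm A \<le> c" "spectral_norm B \<le> c" "1 \<le> c"
  shows "spectral_norm (mat_pow A k - mat_pow B k) \<le> real k * c ^ k * spectral_norm (A - B)"
proof (induction k)
  case 0
  then show ?case using spectral_norm_scaleR[of 0 "0 :: real ^ 'a ^ 'a"] by simp
next
  case (Suc k)
  let ?d = "spectral_norm (A - B)"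
  have c: "0 \<le> c" "c ^ k \<le> c ^ Suc k" using assms(3) by (auto intro: power_increasing)
  have "mat_pow A (Suc k) - mat_pow B (Suc k)
      = A ** (mat_pow A k - mat_pow B k) + (A - B) ** mat_pow B k"
    by (simp add: matrix_mult_diff_ldistrib matrix_mult_diff_rdistrib)
  then have "spectral_norm (mat_pow A (Suc k) - mat_pow B (Suc k))
      \<le> spectral_norm (A ** (mat_pow A k - mat_pow B k)) + spectral_norm ((A - B) ** mat_pow B k)"
    by (simp add: spectral_norm_triangle)
  also have "\<dots> \<le> spectral_norm A * spectral_norm (mat_pow A k - mat_pow B k)
      + ?d * spectral_norm (mat_pow B k)"
    by (intro add_mono spectral_norm_mult)
  also have "\<dots> \<le> c * (real k * c ^ k * ?d) + ?d * c ^ k"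
    by (intro add_mono mult_mono assms Suc order_refl spectral_norm_mat_pow spectral_norm_nonneg c)
  also have "\<dots> \<le> c * (real k * c ^ k * ?d) + ?d * c ^ Suc k"
    using c(2) spectral_norm_nonneg[of "A - B"] by (intro add_left_mono mult_left_mono)
  also have "\<dots> = real (Suc k) * c ^ Suc k * ?d"
    by (simp add: algebra_simps)
  finally show ?case .
qed

subsection \<open>One step of the trace recursion\<close>

text \<open>Second-order expansion whose remainder has a factor Y on both sides, so that its
  quadratic form at w is controlled by the norm of Y w. The middle factor H obeys the bound of the
  scalar expansion of (1 + y)^k; the product with \<open>y\<^sup>2\<close> instead of a quotient
  keeps the claim meaningful for y = 0.\<close>

lemma mat_pow_one_plus_expansion:
  fixes Y :: "real ^ 'm ^ 'm"
  assumes "spectral_norm Y \<le> y"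
  shows "\<exists>H. mat_pow (mat 1 + Y) k = mat 1 + real k *\<^sub>R Y + Y ** H ** Y
    \<and> spectral_norm H * y\<^sup>2 \<le> (1 + y) ^ k - 1 - real k * y"
proof (induction k)
  case 0
  have "spectral_norm (0 :: real ^ 'm ^ 'm) = 0"
    using spectral_norm_scaleR[of 0 "0 :: real ^ 'm ^ 'm"] by simp
  then show ?case by (intro exI[of _ 0]) simp
next
  case (Suc k)
  then obtain H where H: "mat_pow (mat 1 + Y) k = mat 1 + real k *\<^sub>R Y + Y ** H ** Y"
    and Hle: "spectral_norm H * y\<^sup>2 \<le> (1 + y) ^ k - 1 - real k * y" by blast
  have y: "0 \<le> y" using assms spectral_norm_nonneg order_trans by blast
  \<comment> \<open>Multiplying the expansion from the left by 1 + Y produces the additional terms Y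
    (k 1) Y and Y (Y H) Y.\<close>
  let ?H = "H + real k *\<^sub>R mat 1 + Y ** H"
  have "mat_pow (mat 1 + Y) (Suc k) = mat 1 + real (Suc k) *\<^sub>R Y + Y ** ?H ** Y"
    by (simp only: mat_pow.simps H) (simp add: matrix_add_ldistrib matrix_mult_add_rdistrib matrix_mult_scaleR_left
        matrix_mult_scaleR_right matrix_mul_assoc algebra_simps)
  moreover have "spectral_norm ?H * y\<^sup>2 \<le> (1 + y) ^ Suc k - 1 - real (Suc k) * y"
  proof -
    have "spectral_norm ?H \<le> spectral_norm H + spectral_norm (real k *\<^sub>R mat 1 :: real ^ 'm ^ 'm)
        + spectral_norm (Y ** H)"
      using spectral_norm_triangle[of "H + real k *\<^sub>R mat 1" "Y ** H"]
        spectral_norm_triangle[of H "real k *\<^sub>R mat 1"] by linarith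
    also have "\<dots> \<le> spectral_norm H + real k + y * spectral_norm H"
    proof (intro add_mono order_refl)
      show "spectral_norm (real k *\<^sub>R mat 1 :: real ^ 'm ^ 'm) \<le> real k"
        using mult_left_mono[OF spectral_norm_mat_1[where 'n = 'm], of "real k"]
        by (simp add: spectral_norm_scaleR)
      show "spectral_norm (Y ** H) \<le> y * spectral_norm H"
        using spectral_norm_mult[of Y H] mult_right_mono[OF assms spectral_norm_nonneg[of H]]
        by linarith
    qed
    finally have "spectral_norm ?H * y\<^sup>2 \<le> (spectral_norm H + real k + y * spectral_norm H) * y\<^sup>2"
      by (rule mult_right_mono) simp
    also have "\<dots> = (spectral_norm H * y\<^sup>2) * (1 + y) + real k * y\<^sup>2"
      by (simp add: algebra_simps)
    also have "\<dots> \<le> ((1 + y) ^ k - 1 - real k * y) * (1 + y) + real k * y\<^sup>2"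
      by (intro add_right_mono mult_right_mono Hle) (use y in simp)
    also have "\<dots> = (1 + y) ^ Suc k - 1 - real (Suc k) * y"
      by (simp add: algebra_simps power2_eq_square)
    finally show ?thesis .
  qed
  ultimately show ?case by blast
qed

lemma one_plus_div_power_le_exp:
  fixes x :: real
  assumes "0 \<le> x"
  shows "(1 + x / real N) ^ N \<le> exp x"
  using exp_ge_one_plus_x_over_n_power_n[of N x] assms by (cases "N = 0") auto

text \<open>The analogue, uniform in N, of exp X being at most 1 + X + r X^2 as a quadratic form,
  where r = (e^L - 1 - L) / L^2. For Y = X / N the remainder Y H Y contributes the inner product of
  Y w and H Y w, and the powers of N cancel against the bound on H.\<close>

lemma quadratic_form_mat_pow_le:
  fixes X :: "real ^ 'm ^ 'm"
  assumes sym: "transpose X = X" and X: "spectral_norm X \<le> L" and "0 < L" "0 < N"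
  shows "w \<bullet> (mat_pow (mat 1 + (1 / real N) *\<^sub>R X) N *v w)
    \<le> (norm w)\<^sup>2 + w \<bullet> (X *v w) + (exp L - 1 - L) / L\<^sup>2 * (norm (X *v w))\<^sup>2"
proof -
  let ?Y = "(1 / real N) *\<^sub>R X" and ?y = "L / real N"
  have "spectral_norm ?Y \<le> ?y"
    using X \<open>0 < N\<close> by (simp add: spectral_norm_scaleR divide_right_mono)
  then obtain H where H: "mat_pow (mat 1 + ?Y) N = mat 1 + real N *\<^sub>R ?Y + ?Y ** H ** ?Y"
    and Hle: "spectral_norm H * ?y\<^sup>2 \<le> (1 + ?y) ^ N - 1 - real N * ?y"
    using mat_pow_one_plus_expansion by blast
  have "spectral_norm H * ?y\<^sup>2 \<le> exp L - 1 - L"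
    using Hle one_plus_div_power_le_exp[of L N] assms(3,4) by simp
  then have Hle': "spectral_norm H / (real N)\<^sup>2 \<le> (exp L - 1 - L) / L\<^sup>2"
    using \<open>0 < L\<close> \<open>0 < N\<close> by (simp add: field_simps)
  have "w \<bullet> (mat_pow (mat 1 + ?Y) N *v w) = (norm w)\<^sup>2 + w \<bullet> (X *v w) + (?Y *v w) \<bullet> (H *v (?Y *v w))"
  proof -
    have "mat_pow (mat 1 + ?Y) N *v w = w + X *v w + ?Y *v (H *v (?Y *v w))"
      using \<open>0 < N\<close> by (simp only: H) (simp add: matrix_vector_mult_add_rdistrib matrix_vector_mul_assoc matrix_mul_assoc)
    moreover have "transpose ?Y = ?Y"
      using sym by (simp add: vec_eq_iff transpose_def)
    ultimately show ?thesis
      by (simp only: inner_add_right inner_symmetric_matrix) (simp add: power2_norm_eq_inner)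
  qed
  also have "(?Y *v w) \<bullet> (H *v (?Y *v w)) \<le> spectral_norm H * (norm (?Y *v w))\<^sup>2"
  proof -
    have "(?Y *v w) \<bullet> (H *v (?Y *v w)) \<le> norm (?Y *v w) * norm (H *v (?Y *v w))"
      by (rule norm_cauchy_schwarz)
    also have "\<dots> \<le> norm (?Y *v w) * (spectral_norm H * norm (?Y *v w))"
      by (intro mult_left_mono norm_mult_spectral_norm) simp
    finally show ?thesis by (simp add: power2_eq_square mult_ac)
  qed
  also have "spectral_norm H * (norm (?Y *v w))\<^sup>2 = spectral_norm H / (real N)\<^sup>2 * (norm (X *v w))\<^sup>2"
    by (simp add: scaleR_matrix_vector_assoc[symmetric] power_divide)
  also have "\<dots> \<le> (exp L - 1 - L) / L\<^sup>2 * (norm (X *v w))\<^sup>2"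
    by (intro mult_right_mono Hle') simp
  finally show ?thesis by simp
qed

text \<open>Expresses the trace through quadratic forms of G at the vectors Q e_i, so that a bound
  on the expected quadratic form of a random G passes to the expected trace.\<close>

lemma trace_square_mult:
  fixes Q G :: "real ^ 'm ^ 'm"
  assumes "transpose Q = Q"
  shows "trace (Q ** Q ** G) = (\<Sum>i\<in>UNIV. (Q *v axis i 1) \<bullet> (G *v (Q *v axis i 1)))"
proof -
  have "trace (Q ** Q ** G) = trace (Q ** (G ** Q))"
    by (metis matrix_mul_assoc trace_mul_sym)
  also have "\<dots> = (\<Sum>i\<in>UNIV. axis i 1 \<bullet> ((Q ** (G ** Q)) *v axis i 1))"
    unfolding trace_def by (simp add: inner_axis' matrix_vector_mult_basis column_def)
  also have "\<dots> = (\<Sum>i\<in>UNIV. axis i 1 \<bullet> (Q *v (G *v (Q *v axis i 1))))"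
    by (simp add: matrix_vector_mul_assoc)
  also have "\<dots> = (\<Sum>i\<in>UNIV. (Q *v axis i 1) \<bullet> (G *v (Q *v axis i 1)))"
    by (simp only: inner_symmetric_matrix[OF assms])
  finally show ?thesis .
qed

definition trace_exp_approx :: "nat \<Rightarrow> real ^ 'm ^ 'm \<Rightarrow> real" where
  "trace_exp_approx N S = trace (mat_pow (mat 1 + (1 / real N) *\<^sub>R S) N)"

lemma transpose_one_plus: "transpose S = S \<Longrightarrow> transpose (mat 1 + c *\<^sub>R S) = mat 1 + c *\<^sub>R S"
  for S :: "real ^ 'm ^ 'm"
  by (simp add: transpose_add transpose_mat transpose_scalar)

text \<open>Takes the place of Golden--Thompson. The matrices 1 + (A + B) / N and (1 + A / N) (1 + B
  / N) differ only by A B / N^2, hence their N-th powers by O(1/N); the trace inequality for powers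
  of a product of symmetric matrices then separates the factors.\<close>

lemma trace_exp_approx_add:
  fixes A B :: "real ^ 'm ^ 'm"
  assumes "transpose A = A" "transpose B = B" and a: "spectral_norm A \<le> a" and b: "spectral_norm B \<le> b"
    and N: "N = 2 ^ k"
  shows "trace_exp_approx N (A + B)
    \<le> trace (mat_pow (mat 1 + (1 / real N) *\<^sub>R A) N ** mat_pow (mat 1 + (1 / real N) *\<^sub>R B) N)
      + real CARD('m) * a * b * exp (a + b) / real N"
proof -
  let ?A = "(1 / real N) *\<^sub>R A" and ?B = "(1 / real N) *\<^sub>R B"
  let ?R = "mat 1 + (1 / real N) *\<^sub>R (A + B)" and ?R' = "(mat 1 + ?A) ** (mat 1 + ?B)"
  let ?c = "(1 + a / real N) * (1 + b / real N)"
  have ab: "0 \<le> a" "0 \<le> b" using a b spectral_norm_nonneg order_trans by blast+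
  have N0: "0 < real N" using N by simp
  have nA: "spectral_norm ?A \<le> a / real N" and nB: "spectral_norm ?B \<le> b / real N"
    using a b N0 by (simp_all add: spectral_norm_scaleR divide_right_mono)
  have one: "spectral_norm (mat 1 + Z) \<le> 1 + z" if "spectral_norm Z \<le> z" for Z :: "real ^ 'm ^ 'm" and z
    using spectral_norm_triangle[of "mat 1" Z] spectral_norm_mat_1[where 'n = 'm] that by linarith
  have c1: "1 \<le> ?c"
    using ab N0 mult_mono[of 1 "1 + a / real N" 1 "1 + b / real N"] by simp
  have cR': "spectral_norm ?R' \<le> ?c"
    by (rule order_trans[OF spectral_norm_mult])
      (intro mult_mono one nA nB spectral_norm_nonneg, use ab N0 in simp)
  have cR: "spectral_norm ?R \<le> ?c"
  proof -
    have "spectral_norm (?A + ?B) \<le> a / real N + b / real N"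
      using spectral_norm_triangle[of ?A ?B] nA nB by linarith
    then have "spectral_norm ?R \<le> 1 + (a / real N + b / real N)"
      using one[of "?A + ?B"] by (simp add: scaleR_add_right)
    also have "\<dots> \<le> ?c"
      using ab N0 by (simp add: algebra_simps)
    finally show ?thesis .
  qed
  have diff: "spectral_norm (?R - ?R') \<le> a * b / (real N)\<^sup>2"
  proof -
    have "?R - ?R' = (- 1) *\<^sub>R (?A ** ?B)"
      by (simp add: matrix_add_ldistrib matrix_mult_add_rdistrib scaleR_add_right)
    then have "spectral_norm (?R - ?R') = spectral_norm (?A ** ?B)"
      by (simp only: spectral_norm_scaleR)
    also have "\<dots> \<le> (a / real N) * (b / real N)"
      by (rule order_trans[OF spectral_norm_mult])
        (intro mult_mono nA nB spectral_norm_nonneg, use ab N0 in simp)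
    finally show ?thesis by (simp add: power2_eq_square)
  qed
  have cN: "?c ^ N \<le> exp (a + b)"
    unfolding power_mult_distrib exp_add
    by (intro mult_mono one_plus_div_power_le_exp ab) (use ab in auto)
  have "trace (mat_pow ?R N) - trace (mat_pow ?R' N)
      \<le> real CARD('m) * spectral_norm (mat_pow ?R N - mat_pow ?R' N)"
    using trace_le_spectral_norm[of "mat_pow ?R N - mat_pow ?R' N"] by (simp add: trace_sub)
  also have "\<dots> \<le> real CARD('m) * (real N * ?c ^ N * spectral_norm (?R - ?R'))"
    by (intro mult_left_mono spectral_norm_mat_pow_diff cR cR' c1) simp
  also have "\<dots> \<le> real CARD('m) * (real N * exp (a + b) * (a * b / (real N)\<^sup>2))"
    by (intro mult_left_mono mult_mono cN diff spectral_norm_nonneg) (use ab N0 in auto)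
  also have "\<dots> = real CARD('m) * a * b * exp (a + b) / real N"
    using N0 by (simp add: power2_eq_square)
  finally have "trace (mat_pow ?R N) \<le> trace (mat_pow ?R' N) + real CARD('m) * a * b * exp (a + b) / real N"
    by simp
  also have "trace (mat_pow ?R' N) \<le> trace (mat_pow (mat 1 + ?A) N ** mat_pow (mat 1 + ?B) N)"
    unfolding N by (intro trace_mat_pow_mult_le transpose_one_plus assms)
  finally show ?thesis by (simp add: trace_exp_approx_def)
qed

text \<open>Takes the place of the bound of the trace from below by the largest eigenvalue. For
  symmetric Q and unit w, the form of Q^2 at w is the square of the norm of Q w, hence at least the
  square of the form of Q at w; this is iterated along the powers of two.\<close>

lemma trace_exp_approx_ge:
  fixes S :: "real ^ 'm ^ 'm"
  assumes sym: "transpose S = S" and w: "norm w = 1" and \<tau>: "0 \<le> \<tau>" "\<tau> \<le> w \<bullet> (S *v w)"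
    and N: "N = 2 ^ Suc k"
  shows "(1 + \<tau> / real N) ^ N \<le> trace_exp_approx N S"
proof -
  let ?P = "mat 1 + (1 / real N) *\<^sub>R S"
  have symP: "transpose ?P = ?P" by (rule transpose_one_plus[OF sym])
  have N0: "0 < real N" using N by simp
  have base: "1 + \<tau> / real N \<le> w \<bullet> (?P *v w)"
  proof -
    have "w \<bullet> (?P *v w) = 1 + (w \<bullet> (S *v w)) / real N"
      using w by (simp add: matrix_vector_mult_add_rdistrib inner_add_right power2_norm_eq_inner[symmetric]
          scaleR_matrix_vector_assoc[symmetric])
    then show ?thesis using \<tau>(2) N0 by (simp add: divide_right_mono)
  qed
  have pos: "0 \<le> 1 + \<tau> / real N" using \<tau> N0 by simp
  have quad: "(1 + \<tau> / real N) ^ (2 ^ j) \<le> w \<bullet> (mat_pow ?P (2 ^ j) *v w)" for j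
  proof (induction j)
    case (Suc j)
    let ?Q = "mat_pow ?P (2 ^ j)"
    have symQ: "transpose ?Q = ?Q" by (simp only: transpose_mat_pow symP)
    have "(1 + \<tau> / real N) ^ (2 ^ Suc j) = ((1 + \<tau> / real N) ^ (2 ^ j))\<^sup>2"
      by (simp add: power_mult[symmetric] mult.commute)
    also have "\<dots> \<le> (w \<bullet> (?Q *v w))\<^sup>2"
      by (intro power_mono Suc zero_le_power pos)
    also have "\<dots> \<le> (norm w * norm (?Q *v w))\<^sup>2"
      by (metis Cauchy_Schwarz_ineq2 abs_ge_zero power2_abs power_mono)
    also have "\<dots> = (?Q *v w) \<bullet> (?Q *v w)"
      using w by (simp add: power2_norm_eq_inner)
    also have "\<dots> = w \<bullet> (?Q *v (?Q *v w))"
      by (simp only: inner_symmetric_matrix[OF symQ])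
    also have "\<dots> = w \<bullet> (mat_pow ?P (2 ^ Suc j) *v w)"
      by (simp add: matrix_vector_mul_assoc mat_pow_add[symmetric] mult_2)
    finally show ?case .
  qed (use base in simp)
  \<comment> \<open>N is even, so the trace of the N-th power is the squared Frobenius norm of the
    power N / 2, which dominates its value at the single vector w.\<close>
  let ?Q = "mat_pow ?P (2 ^ k)"
  have symQ: "transpose ?Q = ?Q" by (simp only: transpose_mat_pow symP)
  have "(1 + \<tau> / real N) ^ N \<le> w \<bullet> (mat_pow ?P (2 ^ Suc k) *v w)"
    using quad[of "Suc k"] N by simp
  also have "\<dots> = w \<bullet> (?Q *v (?Q *v w))"
    by (simp add: matrix_vector_mul_assoc mat_pow_add[symmetric] mult_2)
  also have "\<dots> = (norm (?Q *v w))\<^sup>2"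
    by (simp only: inner_symmetric_matrix[OF symQ] power2_norm_eq_inner)
  also have "\<dots> \<le> (norm ?Q)\<^sup>2"
    using norm_mult_spectral_norm[of ?Q w] spectral_norm_le_norm[of ?Q] w
    by (intro power_mono) auto
  also have "\<dots> = trace_exp_approx N S"
    using trace_mat_pow_double[OF symP, of "2 ^ k"] by (simp add: trace_exp_approx_def N)
  finally show ?thesis .
qed

subsection \<open>A matrix Bernstein inequality\<close>

lemma expectation_bind_finite:
  fixes h :: "'b \<Rightarrow> real"
  assumes "finite (set_pmf p)" "\<And>x. x \<in> set_pmf p \<Longrightarrow> finite (set_pmf (f x))"
  shows "measure_pmf.expectation (bind_pmf p f) h
    = measure_pmf.expectation p (\<lambda>x. measure_pmf.expectation (f x) h)"
  using assms pmf_expectation_bind[of "set_pmf p" f p h]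
  by (subst integral_measure_pmf[of "set_pmf p"]) auto

lemma expectation_mono_finite:
  fixes f g :: "'b \<Rightarrow> real"
  assumes "finite (set_pmf p)" "\<And>x. x \<in> set_pmf p \<Longrightarrow> f x \<le> g x"
  shows "measure_pmf.expectation p f \<le> measure_pmf.expectation p g"
  using assms by (intro integral_mono_AE integrable_measure_pmf_finite AE_pmfI)

lemma finite_set_Pi_pmf:
  "finite I \<Longrightarrow> (\<And>i. i \<in> I \<Longrightarrow> finite (set_pmf (p i))) \<Longrightarrow> finite (set_pmf (Pi_pmf I d p))"
  by (auto simp: set_Pi_pmf intro!: finite_PiE_dflt)

text \<open>Draws the last coordinate innermost, so that an induction over the number of samples can
  condition on the earlier ones.\<close>

lemma Pi_pmf_lessThan_Suc:
  "Pi_pmf {..<Suc r} d p = bind_pmf (Pi_pmf {..<r} d p) (\<lambda>\<omega>. map_pmf (fun_upd \<omega> r) (p r))"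
  unfolding lessThan_Suc map_pmf_def
  by (subst Pi_pmf_insert') (simp_all add: bind_commute_pmf[of "p r"])

lemma trace_exp_approx_nonneg:
  assumes "transpose S = S" "N = 2 ^ Suc k"
  shows "0 \<le> trace_exp_approx N S"
  using trace_mat_pow_double[OF transpose_one_plus[OF assms(1)], of "1 / real N" "2 ^ k"]
  by (simp add: trace_exp_approx_def assms(2))

text \<open>One further independent summand costs the factor 1 + V (e^L - 1 - L) / L^2, up to
  O(1/N). After the factors are separated, the trace is a sum of quadratic forms of the random
  factor; in expectation their linear terms vanish and \<open>var\<close> bounds the quadratic ones.
  Hence only scalar expectations occur.\<close>

lemma expectation_trace_exp_approx_step:
  fixes X :: "'a \<Rightarrow> real ^ 'm ^ 'm"
  assumes fin: "finite (set_pmf p)"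
    and sym: "\<And>a. a \<in> set_pmf p \<Longrightarrow> transpose (X a) = X a"
    and bound: "\<And>a. a \<in> set_pmf p \<Longrightarrow> spectral_norm (X a) \<le> L" and "0 < L"
    and mean: "\<And>w. measure_pmf.expectation p (\<lambda>a. w \<bullet> (X a *v w)) = 0"
    and var: "\<And>w. measure_pmf.expectation p (\<lambda>a. (norm (X a *v w))\<^sup>2) \<le> V * (norm w)\<^sup>2"
    and S: "transpose S = S" "spectral_norm S \<le> b" and N: "N = 2 ^ Suc k"
  shows "measure_pmf.expectation p (\<lambda>a. trace_exp_approx N (S + X a))
    \<le> (1 + V * (exp L - 1 - L) / L\<^sup>2) * trace_exp_approx N S
      + real CARD('m) * b * L * exp (b + L) / real N"
proof -
  let ?P = "mat 1 + (1 / real N) *\<^sub>R S" and ?G = "\<lambda>a. mat_pow (mat 1 + (1 / real N) *\<^sub>R X a) N"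
  let ?Q = "mat_pow ?P (2 ^ k)" and ?K = "real CARD('m) * b * L * exp (b + L) / real N"
  let ?r = "(exp L - 1 - L) / L\<^sup>2"
  have N0: "0 < N" using N by simp
  note int = integrable_measure_pmf_finite[OF fin]
  have symP: "transpose ?P = ?P" by (rule transpose_one_plus[OF S(1)])
  have symQ: "transpose ?Q = ?Q" by (simp only: transpose_mat_pow symP)
  have PQ: "mat_pow ?P N = ?Q ** ?Q"
    by (metis N mat_pow_add mult_2 power_Suc)
  have "0 \<le> exp L - 1 - L" using exp_ge_add_one_self[of L] by linarith
  then have r: "0 \<le> ?r" by simp
  have quad: "measure_pmf.expectation p (\<lambda>a. w \<bullet> (?G a *v w)) \<le> (1 + V * (exp L - 1 - L) / L\<^sup>2) * (norm w)\<^sup>2" for w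
  proof -
    have "measure_pmf.expectation p (\<lambda>a. w \<bullet> (?G a *v w))
      \<le> measure_pmf.expectation p (\<lambda>a. (norm w)\<^sup>2 + w \<bullet> (X a *v w) + ?r * (norm (X a *v w))\<^sup>2)"
      by (intro expectation_mono_finite[OF fin] quadratic_form_mat_pow_le sym bound \<open>0 < L\<close> N0)
    also have "\<dots> = (norm w)\<^sup>2 + ?r * measure_pmf.expectation p (\<lambda>a. (norm (X a *v w))\<^sup>2)"
      by (simp add: int mean del: times_divide_eq_left)
    also have "\<dots> \<le> (norm w)\<^sup>2 + ?r * (V * (norm w)\<^sup>2)"
      by (intro add_left_mono mult_left_mono var r)
    finally show ?thesis by (simp add: algebra_simps)
  qed
  have "measure_pmf.expectation p (\<lambda>a. trace_exp_approx N (S + X a))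
      \<le> measure_pmf.expectation p (\<lambda>a. trace (mat_pow ?P N ** ?G a) + ?K)"
    by (intro expectation_mono_finite[OF fin] trace_exp_approx_add[OF S(1) sym S(2) bound N])
  also have "\<dots> = measure_pmf.expectation p
      (\<lambda>a. \<Sum>i\<in>UNIV. (?Q *v axis i 1) \<bullet> (?G a *v (?Q *v axis i 1))) + ?K"
    by (simp add: int PQ trace_square_mult[OF symQ])
  also have "\<dots> = (\<Sum>i\<in>UNIV. measure_pmf.expectation p
      (\<lambda>a. (?Q *v axis i 1) \<bullet> (?G a *v (?Q *v axis i 1)))) + ?K"
    by (simp add: int)
  also have "\<dots> \<le> (\<Sum>i\<in>UNIV. (1 + V * (exp L - 1 - L) / L\<^sup>2) * (norm (?Q *v axis i 1))\<^sup>2) + ?K"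
    by (intro add_right_mono sum_mono quad)
  also have "(\<Sum>i\<in>UNIV. (1 + V * (exp L - 1 - L) / L\<^sup>2) * (norm (?Q *v axis i 1))\<^sup>2)
      = (1 + V * (exp L - 1 - L) / L\<^sup>2) * trace_exp_approx N S"
    using trace_square_mult[OF symQ, of "mat 1"]
    by (simp add: sum_distrib_left[symmetric] trace_exp_approx_def PQ power2_norm_eq_inner)
  finally show ?thesis .
qed

lemma spectral_norm_sum_le:
  fixes f :: "'i \<Rightarrow> real ^ 'n ^ 'm"
  assumes "\<And>i. i \<in> I \<Longrightarrow> spectral_norm (f i) \<le> c"
  shows "spectral_norm (\<Sum>i\<in>I. f i) \<le> real (card I) * c"
  using assms
proof (induction I rule: infinite_finite_induct)
  case (insert i I)
  have "spectral_norm (\<Sum>i\<in>insert i I. f i) \<le> spectral_norm (f i) + spectral_norm (\<Sum>i\<in>I. f i)"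
    using insert by (simp add: spectral_norm_triangle)
  also have "\<dots> \<le> c + real (card I) * c"
    using insert by (intro add_mono) auto
  finally show ?case using insert by (simp add: distrib_right)
qed (use spectral_norm_scaleR[of 0 "0 :: real ^ 'n ^ 'm"] in simp_all)

text \<open>Iterates the step from S = 0, where the trace is the dimension. The constant K may
  depend on \<open>s\<close> but not on \<open>k\<close>, so the error disappears as
  \<open>k\<close> grows.\<close>

lemma expectation_trace_exp_approx_le:
  fixes X :: "'a \<Rightarrow> real ^ 'm ^ 'm"
  assumes fin: "finite (set_pmf p)"
    and sym: "\<And>a. a \<in> set_pmf p \<Longrightarrow> transpose (X a) = X a"
    and bound: "\<And>a. a \<in> set_pmf p \<Longrightarrow> spectral_norm (X a) \<le> L" and "0 < L"
    and mean: "\<And>w. measure_pmf.expectation p (\<lambda>a. w \<bullet> (X a *v w)) = 0"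
    and var: "\<And>w. measure_pmf.expectation p (\<lambda>a. (norm (X a *v w))\<^sup>2) \<le> V * (norm w)\<^sup>2"
    and V: "0 \<le> V"
  shows "\<exists>K. \<forall>k. measure_pmf.expectation (Pi_pmf {..<s} d (\<lambda>_. p))
      (\<lambda>\<omega>. trace_exp_approx (2 ^ Suc k) (\<Sum>t<s. X (\<omega> t)))
    \<le> real CARD('m) * (1 + V * (exp L - 1 - L) / L\<^sup>2) ^ s + K / 2 ^ Suc k"
proof (induction s)
  case 0
  have "mat_pow (mat 1) j = (mat 1 :: real ^ 'm ^ 'm)" for j
    by (induction j) simp_all
  then show ?case
    by (intro exI[of _ 0]) (simp add: trace_exp_approx_def trace_I)
next
  case (Suc s)
  let ?\<gamma> = "1 + V * (exp L - 1 - L) / L\<^sup>2" and ?P = "Pi_pmf {..<s} d (\<lambda>_. p)"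
  \<comment> \<open>Bound on the spectral norm of a sum of \<open>s\<close> samples; it enters only
    the error term.\<close>
  define b where "b = real s * L"
  obtain K where K: "\<And>k. measure_pmf.expectation ?P (\<lambda>\<omega>. trace_exp_approx (2 ^ Suc k) (\<Sum>t<s. X (\<omega> t)))
      \<le> real CARD('m) * ?\<gamma> ^ s + K / 2 ^ Suc k"
    using Suc by blast
  let ?K' = "real CARD('m) * b * L * exp (b + L)"
  have finP: "finite (set_pmf ?P)" by (simp add: fin finite_set_Pi_pmf)
  have "0 \<le> exp L - 1 - L" using exp_ge_add_one_self[of L] by linarith
  then have \<gamma>: "0 \<le> ?\<gamma>" using V by simp
  have "measure_pmf.expectation (Pi_pmf {..<Suc s} d (\<lambda>_. p))
      (\<lambda>\<omega>. trace_exp_approx (2 ^ Suc k) (\<Sum>t<Suc s. X (\<omega> t)))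
    \<le> real CARD('m) * ?\<gamma> ^ Suc s + (?\<gamma> * K + ?K') / 2 ^ Suc k" for k
  proof -
    let ?N = "2 ^ Suc k :: nat"
    have "Pi_pmf {..<Suc s} d (\<lambda>_. p) = bind_pmf ?P (\<lambda>\<omega>. map_pmf (fun_upd \<omega> s) p)"
      by (rule Pi_pmf_lessThan_Suc)
    then have "measure_pmf.expectation (Pi_pmf {..<Suc s} d (\<lambda>_. p))
        (\<lambda>\<omega>. trace_exp_approx ?N (\<Sum>t<Suc s. X (\<omega> t)))
      = measure_pmf.expectation ?P (\<lambda>\<omega>. measure_pmf.expectation p
          (\<lambda>a. trace_exp_approx ?N ((\<Sum>t<s. X (\<omega> t)) + X a)))"
      by (simp add: expectation_bind_finite finP fin)
    also have "\<dots> \<le> measure_pmf.expectation ?P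
        (\<lambda>\<omega>. ?\<gamma> * trace_exp_approx ?N (\<Sum>t<s. X (\<omega> t)) + ?K' / real ?N)"
    proof (intro expectation_mono_finite[OF finP] expectation_trace_exp_approx_step[OF fin])
      fix \<omega> assume "\<omega> \<in> set_pmf ?P"
      then have \<omega>: "\<omega> t \<in> set_pmf p" if "t < s" for t
        using that by (auto simp: set_Pi_pmf PiE_dflt_def)
      show "transpose (\<Sum>t<s. X (\<omega> t)) = (\<Sum>t<s. X (\<omega> t))"
        by (simp add: transpose_sum sym \<omega>)
      show "spectral_norm (\<Sum>t<s. X (\<omega> t)) \<le> b"
        using spectral_norm_sum_le[of "{..<s}" "\<lambda>t. X (\<omega> t)" L] by (simp add: bound \<omega> b_def)
    qed (simp_all add: sym bound \<open>0 < L\<close> mean var)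
    also have "\<dots> = ?\<gamma> * measure_pmf.expectation ?P (\<lambda>\<omega>. trace_exp_approx ?N (\<Sum>t<s. X (\<omega> t))) + ?K' / real ?N"
      by (simp add: integrable_measure_pmf_finite[OF finP])
    also have "\<dots> \<le> ?\<gamma> * (real CARD('m) * ?\<gamma> ^ s + K / 2 ^ Suc k) + ?K' / real ?N"
      by (intro add_right_mono mult_left_mono K \<gamma>)
    also have "\<dots> = real CARD('m) * ?\<gamma> ^ Suc s + (?\<gamma> * K + ?K') / 2 ^ Suc k"
    proof -
      have *: "g * (m * g ^ s + K / z) + c / z = m * g ^ Suc s + (g * K + c) / z" for g m c z :: real
        by (simp add: distrib_left add_divide_distrib)
      show ?thesis using *[of ?\<gamma>] by simp
    qed
    finally show ?thesis .
  qed
  then show ?case by blast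
qed

text \<open>Markov's inequality for \<open>trace_exp_approx\<close>, followed by the limit in N. A
  scaling of \<open>X\<close> plays the role of the Chernoff parameter.\<close>

lemma matrix_bernstein:
  fixes X :: "'a \<Rightarrow> real ^ 'm ^ 'm"
  assumes fin: "finite (set_pmf p)"
    and sym: "\<And>a. a \<in> set_pmf p \<Longrightarrow> transpose (X a) = X a"
    and bound: "\<And>a. a \<in> set_pmf p \<Longrightarrow> spectral_norm (X a) \<le> L" and "0 < L"
    and mean: "\<And>w. measure_pmf.expectation p (\<lambda>a. w \<bullet> (X a *v w)) = 0"
    and var: "\<And>w. measure_pmf.expectation p (\<lambda>a. (norm (X a *v w))\<^sup>2) \<le> V * (norm w)\<^sup>2"
    and V: "0 \<le> V" and \<tau>: "0 \<le> \<tau>"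
  shows "measure_pmf.prob (Pi_pmf {..<s} d (\<lambda>_. p))
      {\<omega>. \<exists>w. norm w = 1 \<and> \<tau> \<le> w \<bullet> ((\<Sum>t<s. X (\<omega> t)) *v w)}
    \<le> real CARD('m) * exp (real s * V * (exp L - 1 - L) / L\<^sup>2 - \<tau>)"
    (is "measure_pmf.prob ?P ?E \<le> _")
proof -
  let ?\<gamma> = "1 + V * (exp L - 1 - L) / L\<^sup>2" and ?S = "\<lambda>\<omega>. \<Sum>t<s. X (\<omega> t)"
  have finP: "finite (set_pmf ?P)" by (simp add: fin finite_set_Pi_pmf)
  have r: "0 \<le> exp L - 1 - L" using exp_ge_add_one_self[of L] by linarith
  obtain K where K: "\<And>k. measure_pmf.expectation ?P (\<lambda>\<omega>. trace_exp_approx (2 ^ Suc k) (?S \<omega>))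
      \<le> real CARD('m) * ?\<gamma> ^ s + K / 2 ^ Suc k"
    using expectation_trace_exp_approx_le[OF assms(1-7)] by blast
  have step: "measure_pmf.prob ?P ?E * (1 + \<tau> / real (2 ^ Suc k)) ^ (2 ^ Suc k)
      \<le> real CARD('m) * ?\<gamma> ^ s + K / real (2 ^ Suc k)" for k
  proof -
    let ?N = "2 ^ Suc k :: nat"
    have "measure_pmf.prob ?P ?E * (1 + \<tau> / real ?N) ^ ?N
        = measure_pmf.expectation ?P (\<lambda>\<omega>. indicator ?E \<omega> * (1 + \<tau> / real ?N) ^ ?N)"
      by simp
    \<comment> \<open>On the event the trace is at least (1 + \<tau>/N)^N; off the event it is
      nonnegative because N is even.\<close>
    also have "\<dots> \<le> measure_pmf.expectation ?P (\<lambda>\<omega>. trace_exp_approx ?N (?S \<omega>))"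
    proof (intro expectation_mono_finite[OF finP])
      fix \<omega> assume "\<omega> \<in> set_pmf ?P"
      then have "transpose (?S \<omega>) = ?S \<omega>"
        by (auto simp: transpose_sum set_Pi_pmf PiE_dflt_def intro!: sum.cong sym)
      then show "indicator ?E \<omega> * (1 + \<tau> / real ?N) ^ ?N \<le> trace_exp_approx ?N (?S \<omega>)"
        using trace_exp_approx_ge[of "?S \<omega>" _ \<tau> ?N k] trace_exp_approx_nonneg[of "?S \<omega>" ?N k] \<tau>
        by (auto simp: indicator_def)
    qed
    also have "\<dots> \<le> real CARD('m) * ?\<gamma> ^ s + K / real ?N"
      using K[of k] by simp
    finally show ?thesis .
  qed
  have sub: "filterlim (\<lambda>k. 2 ^ Suc k :: nat) sequentially sequentially"
    by (rule filterlim_subseq) (simp add: strict_mono_Suc_iff)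
  have "(\<lambda>k. measure_pmf.prob ?P ?E * (1 + \<tau> / real (2 ^ Suc k)) ^ (2 ^ Suc k))
      \<longlonglongrightarrow> measure_pmf.prob ?P ?E * exp \<tau>"
    by (rule tendsto_mult_left, rule filterlim_compose[OF tendsto_exp_limit_sequentially sub])
  moreover have "(\<lambda>k. real CARD('m) * ?\<gamma> ^ s + K / real (2 ^ Suc k)) \<longlonglongrightarrow> real CARD('m) * ?\<gamma> ^ s + 0"
    by (rule tendsto_add[OF tendsto_const], rule filterlim_compose[OF lim_const_over_n sub])
  ultimately have "measure_pmf.prob ?P ?E * exp \<tau> \<le> real CARD('m) * ?\<gamma> ^ s"
    using LIMSEQ_le step by fastforce
  also have "?\<gamma> ^ s \<le> exp (V * (exp L - 1 - L) / L\<^sup>2) ^ s"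
    using V r by (intro power_mono exp_ge_add_one_self) simp
  also have "\<dots> = exp (real s * V * (exp L - 1 - L) / L\<^sup>2)"
    by (simp add: exp_of_nat_mult[symmetric] mult.assoc)
  finally show ?thesis
    by (simp add: exp_diff field_simps)
qed

subsection \<open>Self-adjoint dilation\<close>

text \<open>The block matrix with zero diagonal blocks and off-diagonal blocks Y and Y^T. The
  maximum of its quadratic form over unit vectors is the spectral norm of Y, so a one-sided bound
  for symmetric matrices covers arbitrary Y.\<close>

definition dilation :: "real ^ 'n ^ 'm \<Rightarrow> real ^ ('m + 'n) ^ ('m + 'n)" where
  "dilation Y = (\<chi> a b. case a of
      Inl i \<Rightarrow> (case b of Inl i' \<Rightarrow> 0 | Inr j \<Rightarrow> Y $ i $ j)
    | Inr j \<Rightarrow> (case b of Inl i \<Rightarrow> Y $ i $ j | Inr j' \<Rightarrow> 0))"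

definition vec_Inl :: "'a ^ ('m::finite + 'n::finite) \<Rightarrow> 'a ^ 'm" where
  "vec_Inl w = (\<chi> i. w $ Inl i)"

definition vec_Inr :: "'a ^ ('m::finite + 'n::finite) \<Rightarrow> 'a ^ 'n" where
  "vec_Inr w = (\<chi> j. w $ Inr j)"

lemma sum_UNIV_Plus: "(\<Sum>a\<in>UNIV. f a) = (\<Sum>i\<in>UNIV. f (Inl i)) + (\<Sum>j\<in>UNIV. f (Inr j))"
  for f :: "'m::finite + 'n::finite \<Rightarrow> 'b::comm_monoid_add"
  by (simp add: UNIV_Plus_UNIV[symmetric] sum.Plus del: UNIV_Plus_UNIV)

lemma inner_vec_Plus: "v \<bullet> w = vec_Inl v \<bullet> vec_Inl w + vec_Inr v \<bullet> vec_Inr w"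
  for v w :: "real ^ ('m::finite + 'n::finite)"
  by (simp add: inner_vec_def sum_UNIV_Plus vec_Inl_def vec_Inr_def)

lemma norm_vec_Plus: "(norm w)\<^sup>2 = (norm (vec_Inl w))\<^sup>2 + (norm (vec_Inr w))\<^sup>2"
  for w :: "real ^ ('m::finite + 'n::finite)"
  by (simp add: power2_norm_eq_inner inner_vec_Plus)

lemma vec_Inl_dilation_mult: "vec_Inl (dilation Y *v w) = Y *v vec_Inr w"
  by (simp add: vec_eq_iff vec_Inl_def vec_Inr_def dilation_def matrix_vector_mult_def sum_UNIV_Plus)

lemma vec_Inr_dilation_mult: "vec_Inr (dilation Y *v w) = transpose Y *v vec_Inl w"
  by (simp add: vec_eq_iff vec_Inl_def vec_Inr_def dilation_def matrix_vector_mult_def sum_UNIV_Plus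
      transpose_def)

lemma norm_dilation_mult:
  "(norm (dilation Y *v w))\<^sup>2 = (norm (Y *v vec_Inr w))\<^sup>2 + (norm (transpose Y *v vec_Inl w))\<^sup>2"
  by (simp add: norm_vec_Plus vec_Inl_dilation_mult vec_Inr_dilation_mult)

lemma inner_dilation_mult: "w \<bullet> (dilation Y *v w) = 2 * (vec_Inl w \<bullet> (Y *v vec_Inr w))"
  by (simp add: inner_vec_Plus vec_Inl_dilation_mult vec_Inr_dilation_mult dot_lmul_matrix
      inner_commute[of "vec_Inr w"])

lemma transpose_dilation: "transpose (dilation Y) = dilation Y"
  by (auto simp: vec_eq_iff transpose_def dilation_def split: sum.split)

lemma dilation_sum: "dilation (\<Sum>i\<in>I. f i) = (\<Sum>i\<in>I. dilation (f i))"
  by (auto simp: vec_eq_iff dilation_def split: sum.split)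

text \<open>The Frobenius norm is precise enough here: a sample has at most one nonzero entry, and B
  itself satisfies the same norm bound as the samples.\<close>

lemma spectral_norm_dilation_le: "spectral_norm (dilation Y) \<le> norm Y" for Y :: "real ^ 'n ^ 'm"
proof (rule spectral_norm_le)
  fix w :: "real ^ ('m + 'n)"
  have le: "norm (Z *v x) \<le> norm Z * norm x" for Z :: "real ^ 'k ^ 'l" and x
    using norm_mult_spectral_norm[of Z x] mult_right_mono[OF spectral_norm_le_norm[of Z], of "norm x"]
    by simp
  have "(norm (dilation Y *v w))\<^sup>2 \<le> (norm Y * norm (vec_Inr w))\<^sup>2 + (norm Y * norm (vec_Inl w))\<^sup>2"
    unfolding norm_dilation_mult
    using le[of Y "vec_Inr w"] le[of "transpose Y" "vec_Inl w"]
    by (intro add_mono power_mono) (auto simp: norm_transpose)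
  also have "\<dots> = (norm Y * norm w)\<^sup>2"
    by (simp add: power_mult_distrib norm_vec_Plus[of w] distrib_left)
  finally show "norm (dilation Y *v w) \<le> norm Y * norm w"
    by (rule power2_le_imp_le) simp
qed

lemma spectral_norm_less_imp_dilation:
  fixes Y :: "real ^ 'n ^ 'm"
  assumes "c < spectral_norm Y" "0 \<le> c"
  obtains w where "norm w = 1" "c \<le> w \<bullet> (dilation Y *v w)"
proof -
  obtain x where x: "c * norm x < norm (Y *v x)"
    using spectral_norm_le[of Y c] assms(1) by (meson not_less)
  then have "x \<noteq> 0" by auto
  have "Y *v x \<noteq> 0" using x mult_nonneg_nonneg[OF assms(2) norm_ge_zero[of x]] by auto
  \<comment> \<open>The normalised vectors Y x and x, each weighted by 1 / sqrt 2 so that w is a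
    unit vector. The two off-diagonal blocks contribute equally, which gives the norm of Y x divided
    by that of x.\<close>
  define w :: "real ^ ('m + 'n)" where
    "w = (\<chi> a. (case a of Inl i \<Rightarrow> sgn (Y *v x) $ i | Inr j \<Rightarrow> sgn x $ j) / sqrt 2)"
  have w: "vec_Inl w = (1 / sqrt 2) *\<^sub>R sgn (Y *v x)" "vec_Inr w = (1 / sqrt 2) *\<^sub>R sgn x"
    by (simp_all add: vec_eq_iff w_def vec_Inl_def vec_Inr_def)
  have "(norm w)\<^sup>2 = 1"
    using \<open>x \<noteq> 0\<close> \<open>Y *v x \<noteq> 0\<close> by (simp add: norm_vec_Plus w norm_sgn power_divide)
  then have "norm w = 1" using norm_ge_zero[of w] by (simp add: power2_eq_1_iff)
  moreover have "w \<bullet> (dilation Y *v w) = norm (Y *v x) / norm x"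
    using \<open>Y *v x \<noteq> 0\<close> \<open>x \<noteq> 0\<close>
    by (simp add: inner_dilation_mult w sgn_div_norm matrix_vector_mult_scaleR
        dot_square_norm power2_eq_square) (simp add: field_simps)
  moreover have "c \<le> norm (Y *v x) / norm x"
    using x \<open>x \<noteq> 0\<close> by (simp add: field_simps)
  ultimately show thesis
    by (intro that[of w]) simp_all
qed

subsection \<open>The sampling error\<close>

lemma matrix_unit_nth: "matrix_unit i j $ a $ b = (if a = i \<and> b = j then 1 else 0)"
  by (simp add: matrix_unit_def matrix_matrix_mult_def columnvector_def rowvector_def axis_def)

lemma matrix_unit_mult_vec: "matrix_unit i j *v v = v $ j *\<^sub>R axis i 1"
  by (auto simp: vec_eq_iff matrix_vector_mult_def matrix_unit_nth axis_def if_distrib if_distribR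
      cong: if_cong)

lemma transpose_matrix_unit: "transpose (matrix_unit i j) = matrix_unit j i"
  by (auto simp: vec_eq_iff transpose_def matrix_unit_nth)

lemma norm_matrix_unit: "norm (matrix_unit i j) = 1"
proof -
  have "matrix_unit i j = axis i (axis j 1)"
    by (auto simp: vec_eq_iff matrix_unit_nth axis_def)
  then show ?thesis by (simp add: norm_eq_1 inner_axis_axis)
qed

lemma norm_matrix_squared: "(norm B)\<^sup>2 = (\<Sum>i\<in>UNIV. \<Sum>j\<in>UNIV. (B $ i $ j)\<^sup>2)" for B :: "real ^ 'n ^ 'm"
  by (simp add: norm_matrix frobenius_norm_def sum_nonneg)

lemma sum_UNIV_prod: "(\<Sum>x\<in>UNIV. f x) = (\<Sum>i\<in>UNIV. \<Sum>j\<in>UNIV. f (i, j))"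
  for f :: "'m::finite \<times> 'n::finite \<Rightarrow> 'b::comm_monoid_add"
  by (simp add: UNIV_Times_UNIV[symmetric] sum.cartesian_product del: UNIV_Times_UNIV)

lemma pmf_entry_pmf:
  assumes "B \<noteq> 0"
  shows "pmf (entry_pmf B) x = entry_prob B x"
  unfolding entry_pmf_def
proof (rule pmf_embed_pmf)
  show nn: "0 \<le> entry_prob B x" for x
    by (simp add: entry_prob_def split: prod.split)
  have "(\<Sum>x\<in>UNIV. entry_prob B x) = (norm B)\<^sup>2 / (norm B)\<^sup>2"
    by (simp add: sum_UNIV_prod entry_prob_def norm_matrix_squared norm_matrix[symmetric]
        sum_divide_distrib[symmetric])
  also have "\<dots> = 1" using assms by simp
  finally show "(\<integral>\<^sup>+ x. ennreal (entry_prob B x) \<partial>count_space UNIV) = 1"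
    by (simp add: nn_integral_count_space_finite sum_ennreal nn)
qed

definition sample :: "real ^ 'n ^ 'n \<Rightarrow> 'n \<times> 'n \<Rightarrow> real ^ 'n ^ 'n" where
  "sample B = (\<lambda>(i, j). (B $ i $ j / entry_prob B (i, j)) *\<^sub>R matrix_unit i j)"

lemma sample_average_eq: "sample_average s B \<omega> = (1 / real s) *\<^sub>R (\<Sum>t<s. sample B (\<omega> t))"
  by (simp add: sample_average_def sample_def)

lemma entry_prob_eq_0_iff: "B \<noteq> 0 \<Longrightarrow> entry_prob B (i, j) = 0 \<longleftrightarrow> B $ i $ j = 0"
  by (simp add: entry_prob_def norm_matrix[symmetric])

text \<open>For a zero entry everything vanishes by x / 0 = 0. Otherwise the second expression is
  exactly the squared Frobenius norm: with probabilities proportional to squares, all nonzero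
  entries contribute equally to the second moment.\<close>

lemma entry_prob_scale:
  assumes "B \<noteq> 0"
  shows "entry_prob B (i, j) * (B $ i $ j / entry_prob B (i, j)) = B $ i $ j"
    and "entry_prob B (i, j) * (B $ i $ j / entry_prob B (i, j))\<^sup>2 \<le> (norm B)\<^sup>2"
  using assms by (auto simp: entry_prob_def norm_matrix[symmetric] field_simps power2_eq_square)

lemma expectation_entry_pmf:
  fixes f :: "'n::finite \<times> 'n \<Rightarrow> real"
  assumes "B \<noteq> 0"
  shows "measure_pmf.expectation (entry_pmf B) f
    = (\<Sum>i\<in>UNIV. \<Sum>j\<in>UNIV. entry_prob B (i, j) * f (i, j))"
  by (subst integral_measure_pmf[of UNIV]) (auto simp: sum_UNIV_prod pmf_entry_pmf[OF assms])

text \<open>Unbiasedness in weak form, which avoids matrix-valued expectations.\<close>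

lemma expectation_sample:
  assumes "B \<noteq> 0"
  shows "measure_pmf.expectation (entry_pmf B) (\<lambda>x. u \<bullet> (sample B x *v v)) = u \<bullet> (B *v v)"
proof -
  have "entry_prob B (i, j) * (u \<bullet> (sample B (i, j) *v v)) = u $ i * (B $ i $ j * v $ j)" for i j
    using arg_cong[OF entry_prob_scale(1)[OF assms, of i j], of "\<lambda>z. z * (v $ j * u $ i)"]
    by (simp add: sample_def scaleR_matrix_vector_assoc[symmetric] matrix_unit_mult_vec inner_axis mult_ac
        entry_prob_eq_0_iff[OF assms])
  then show ?thesis
    by (simp add: expectation_entry_pmf[OF assms] inner_vec_def matrix_vector_mult_def sum_distrib_left)
qed

text \<open>Position (i, j) contributes at most the squared norm of B times (v_j)^2, and each j
  occurs in n rows; for the transpose rows and columns change places.\<close>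

lemma expectation_sample_square:
  fixes B :: "real ^ 'n ^ 'n"
  assumes "B \<noteq> 0"
  shows "measure_pmf.expectation (entry_pmf B) (\<lambda>x. (norm (sample B x *v v))\<^sup>2)
      \<le> real CARD('n) * (norm B)\<^sup>2 * (norm v)\<^sup>2"
    and "measure_pmf.expectation (entry_pmf B) (\<lambda>x. (norm (transpose (sample B x) *v v))\<^sup>2)
      \<le> real CARD('n) * (norm B)\<^sup>2 * (norm v)\<^sup>2"
proof -
  have v: "(norm v)\<^sup>2 = (\<Sum>j\<in>UNIV. (v $ j)\<^sup>2)"
    by (simp add: norm_vec_def L2_set_def sum_nonneg)
  have row: "entry_prob B (i, j) * (norm (sample B (i, j) *v v))\<^sup>2 \<le> (norm B)\<^sup>2 * (v $ j)\<^sup>2" for i j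
    using mult_right_mono[OF entry_prob_scale(2)[OF assms, of i j], of "(v $ j)\<^sup>2"]
    by (simp add: sample_def scaleR_matrix_vector_assoc[symmetric] matrix_unit_mult_vec
        power_mult_distrib power_divide mult_ac)
  have col: "entry_prob B (i, j) * (norm (transpose (sample B (i, j)) *v v))\<^sup>2 \<le> (norm B)\<^sup>2 * (v $ i)\<^sup>2" for i j
    using mult_right_mono[OF entry_prob_scale(2)[OF assms, of i j], of "(v $ i)\<^sup>2"]
    by (simp add: sample_def transpose_scalar transpose_matrix_unit scaleR_matrix_vector_assoc[symmetric]
        matrix_unit_mult_vec power_mult_distrib power_divide mult_ac)
  have "measure_pmf.expectation (entry_pmf B) (\<lambda>x. (norm (sample B x *v v))\<^sup>2)
      \<le> (\<Sum>i\<in>(UNIV :: 'n set). \<Sum>j\<in>UNIV. (norm B)\<^sup>2 * (v $ j)\<^sup>2)"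
    unfolding expectation_entry_pmf[OF assms] by (intro sum_mono row)
  then show "measure_pmf.expectation (entry_pmf B) (\<lambda>x. (norm (sample B x *v v))\<^sup>2)
      \<le> real CARD('n) * (norm B)\<^sup>2 * (norm v)\<^sup>2"
    by (simp add: v sum_distrib_left[symmetric] mult_ac)
  have "measure_pmf.expectation (entry_pmf B) (\<lambda>x. (norm (transpose (sample B x) *v v))\<^sup>2)
      \<le> (\<Sum>i\<in>(UNIV :: 'n set). \<Sum>j\<in>(UNIV :: 'n set). (norm B)\<^sup>2 * (v $ i)\<^sup>2)"
    unfolding expectation_entry_pmf[OF assms] by (intro sum_mono col)
  then show "measure_pmf.expectation (entry_pmf B) (\<lambda>x. (norm (transpose (sample B x) *v v))\<^sup>2)
      \<le> real CARD('n) * (norm B)\<^sup>2 * (norm v)\<^sup>2"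
    by (simp add: v sum_distrib_left[symmetric] mult_ac)
qed

lemma transpose_diff: "transpose (A - B) = transpose A - transpose B" for A B :: "real ^ 'n ^ 'm"
  by (simp add: transpose_def vec_eq_iff)

text \<open>Centring subtracts the squared norm of the mean, so it can only decrease the second
  moment.\<close>

lemma expectation_centered_sample_square:
  fixes B :: "real ^ 'n ^ 'n"
  assumes "B \<noteq> 0"
  shows "measure_pmf.expectation (entry_pmf B) (\<lambda>x. (norm ((sample B x - B) *v v))\<^sup>2)
      \<le> real CARD('n) * (norm B)\<^sup>2 * (norm v)\<^sup>2"
    and "measure_pmf.expectation (entry_pmf B) (\<lambda>x. (norm (transpose (sample B x - B) *v v))\<^sup>2)
      \<le> real CARD('n) * (norm B)\<^sup>2 * (norm v)\<^sup>2"
proof -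
  have fin: "finite (set_pmf (entry_pmf B))" by (rule finite_subset[OF subset_UNIV finite])
  note int = integrable_measure_pmf_finite[OF fin]
  have sq: "(norm (a - b))\<^sup>2 = (norm a)\<^sup>2 - 2 * (b \<bullet> a) + (norm b)\<^sup>2" for a b :: "real ^ 'n"
    by (simp add: power2_norm_eq_inner inner_diff_left inner_diff_right inner_commute)
  have "measure_pmf.expectation (entry_pmf B) (\<lambda>x. (norm ((sample B x - B) *v v))\<^sup>2)
      = measure_pmf.expectation (entry_pmf B) (\<lambda>x. (norm (sample B x *v v))\<^sup>2) - (norm (B *v v))\<^sup>2"
    by (simp add: matrix_vector_mult_diff_rdistrib sq int expectation_sample[OF assms]
        power2_norm_eq_inner[of "B *v v"])
  also have "\<dots> \<le> real CARD('n) * (norm B)\<^sup>2 * (norm v)\<^sup>2"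
    using expectation_sample_square(1)[OF assms, of v] zero_le_power2[of "norm (B *v v)"] by linarith
  finally show "measure_pmf.expectation (entry_pmf B) (\<lambda>x. (norm ((sample B x - B) *v v))\<^sup>2)
      \<le> real CARD('n) * (norm B)\<^sup>2 * (norm v)\<^sup>2" .
  let ?b = "transpose B *v v"
  \<comment> \<open>Moving the transpose across the inner product makes the unbiasedness of
    \<open>sample B\<close> applicable to the mixed term.\<close>
  have cross: "?b \<bullet> (transpose (sample B x) *v v) = v \<bullet> (sample B x *v ?b)" for x
    by (subst inner_commute) (simp add: dot_lmul_matrix)
  have self: "v \<bullet> (B *v ?b) = ?b \<bullet> ?b"
    by (simp add: dot_lmul_matrix)
  have "measure_pmf.expectation (entry_pmf B) (\<lambda>x. (norm (transpose (sample B x - B) *v v))\<^sup>2)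
      = measure_pmf.expectation (entry_pmf B) (\<lambda>x. (norm (transpose (sample B x) *v v))\<^sup>2) - (norm ?b)\<^sup>2"
    by (simp add: transpose_diff matrix_vector_mult_diff_rdistrib sq int cross expectation_sample[OF assms]
        power2_norm_eq_inner[of ?b] self
        del: transpose_matrix_vector integral_inner_right)
  also have "\<dots> \<le> real CARD('n) * (norm B)\<^sup>2 * (norm v)\<^sup>2"
    using expectation_sample_square(2)[OF assms, of v] zero_le_power2[of "norm ?b"] by linarith
  finally show "measure_pmf.expectation (entry_pmf B) (\<lambda>x. (norm (transpose (sample B x - B) *v v))\<^sup>2)
      \<le> real CARD('n) * (norm B)\<^sup>2 * (norm v)\<^sup>2" .
qed

lemma sample_average_tail:
  fixes B :: "real ^ 'n ^ 'n"
  assumes "B \<noteq> 0" and "0 < \<epsilon>" and "0 < s"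
    and large: "\<And>i j. B $ i $ j \<noteq> 0 \<Longrightarrow> \<epsilon> / (2 * real CARD('n)) \<le> \<bar>B $ i $ j\<bar>"
  shows "measure_pmf.prob (Pi_pmf {..<s} d (\<lambda>_. entry_pmf B))
      {\<omega>. \<epsilon> / 2 < spectral_norm (sample_average s B \<omega> - B)}
    \<le> 2 * real CARD('n) * exp (- ((4 - exp 1) * (real s * \<epsilon>\<^sup>2 / (16 * real CARD('n) * (norm B)\<^sup>2))))"
proof -
  let ?n = "real CARD('n)"
  \<comment> \<open>The reciprocal of the bound on the norm of a centred sample, so that the
    Bernstein inequality applies with L = 1.\<close>
  define \<theta> where "\<theta> = \<epsilon> / (4 * ?n * (norm B)\<^sup>2)"
  define X where "X x = \<theta> *\<^sub>R dilation (sample B x - B)" for x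
  define V where "V = \<theta>\<^sup>2 * (?n * (norm B)\<^sup>2)"
  define \<tau> where "\<tau> = \<theta> * (real s * (\<epsilon> / 2))"
  have n: "0 < ?n" by simp
  have B: "0 < norm B" using \<open>B \<noteq> 0\<close> by simp
  have \<theta>: "0 < \<theta>" using assms n B by (simp add: \<theta>_def)
  have fin: "finite (set_pmf (entry_pmf B))" by (rule finite_subset[OF subset_UNIV finite])
  have norm_sample: "norm (sample B (i, j)) \<le> 2 * ?n * (norm B)\<^sup>2 / \<epsilon>" for i j
  proof (cases "B $ i $ j = 0")
    case True
    then show ?thesis using \<open>0 < \<epsilon>\<close> by (simp add: sample_def)
  next
    case False
    have "norm (sample B (i, j)) = (norm B)\<^sup>2 / \<bar>B $ i $ j\<bar>"
      using False
      by (simp add: sample_def norm_matrix_unit entry_prob_def norm_matrix[symmetric] power2_eq_square abs_mult)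
    also have "\<dots> \<le> (norm B)\<^sup>2 / (\<epsilon> / (2 * ?n))"
      using False \<open>0 < \<epsilon>\<close> n by (intro divide_left_mono large mult_pos_pos) auto
    finally show ?thesis by (simp add: mult_ac)
  qed
  \<comment> \<open>B has a nonzero entry, of absolute value at least \<epsilon>/(2n), so its norm
    is at least that large.\<close>
  have norm_B: "norm B \<le> 2 * ?n * (norm B)\<^sup>2 / \<epsilon>"
  proof -
    obtain i j where "B $ i $ j \<noteq> 0" using \<open>B \<noteq> 0\<close> by (auto simp: vec_eq_iff)
    then have "\<epsilon> / (2 * ?n) \<le> norm B"
      using large[of i j] component_le_norm_cart[of "B $ i" j] Finite_Cartesian_Product.norm_nth_le[of B i] by linarith
    then have "norm B * (\<epsilon> / (2 * ?n)) \<le> norm B * norm B"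
      by (intro mult_left_mono) auto
    then show ?thesis using \<open>0 < \<epsilon>\<close> n by (simp add: field_simps power2_eq_square)
  qed
  have symX: "transpose (X x) = X x" for x
    by (simp add: X_def transpose_scalar transpose_dilation)
  have boundX: "spectral_norm (X x) \<le> 1" for x
  proof -
    have "spectral_norm (X x) \<le> \<theta> * norm (sample B x - B)"
      using \<theta> by (simp add: X_def spectral_norm_scaleR spectral_norm_dilation_le)
    also have "\<dots> \<le> \<theta> * (4 * ?n * (norm B)\<^sup>2 / \<epsilon>)"
    proof (rule mult_left_mono)
      have "norm (sample B x - B) \<le> 2 * ?n * (norm B)\<^sup>2 / \<epsilon> + 2 * ?n * (norm B)\<^sup>2 / \<epsilon>"
        by (rule order_trans[OF norm_triangle_ineq4 add_mono[OF norm_sample[of "fst x" "snd x", unfolded prod.collapse] norm_B]])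
      then show "norm (sample B x - B) \<le> 4 * ?n * (norm B)\<^sup>2 / \<epsilon>" by (simp add: field_simps)
    qed (use \<theta> in simp)
    also have "\<dots> = 1" using \<open>0 < \<epsilon>\<close> n B by (simp add: \<theta>_def)
    finally show ?thesis .
  qed
  have meanX: "measure_pmf.expectation (entry_pmf B) (\<lambda>x. w \<bullet> (X x *v w)) = 0" for w
    by (simp add: X_def scaleR_matrix_vector_assoc[symmetric] inner_dilation_mult
        matrix_vector_mult_diff_rdistrib inner_diff_right integrable_measure_pmf_finite[OF fin]
        expectation_sample[OF \<open>B \<noteq> 0\<close>])
  have varX: "measure_pmf.expectation (entry_pmf B) (\<lambda>x. (norm (X x *v w))\<^sup>2) \<le> V * (norm w)\<^sup>2" for w
  proof -
    let ?C = "\<lambda>x. sample B x - B"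
    have "measure_pmf.expectation (entry_pmf B) (\<lambda>x. (norm (X x *v w))\<^sup>2)
        = \<theta>\<^sup>2 * (measure_pmf.expectation (entry_pmf B) (\<lambda>x. (norm (?C x *v vec_Inr w))\<^sup>2)
          + measure_pmf.expectation (entry_pmf B) (\<lambda>x. (norm (transpose (?C x) *v vec_Inl w))\<^sup>2))"
      by (simp add: X_def scaleR_matrix_vector_assoc[symmetric] power_mult_distrib norm_dilation_mult
          integrable_measure_pmf_finite[OF fin] del: transpose_matrix_vector)
    also have "\<dots> \<le> \<theta>\<^sup>2 * (?n * (norm B)\<^sup>2 * (norm (vec_Inr w))\<^sup>2 + ?n * (norm B)\<^sup>2 * (norm (vec_Inl w))\<^sup>2)"
      by (intro mult_left_mono add_mono expectation_centered_sample_square[OF \<open>B \<noteq> 0\<close>]) simp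
    also have "\<dots> = V * (norm w)\<^sup>2"
      by (simp add: V_def norm_vec_Plus[of w] algebra_simps)
    finally show ?thesis .
  qed
  have event: "{\<omega>. \<epsilon> / 2 < spectral_norm (sample_average s B \<omega> - B)}
      \<subseteq> {\<omega>. \<exists>w. norm w = 1 \<and> \<tau> \<le> w \<bullet> ((\<Sum>t<s. X (\<omega> t)) *v w)}"
  proof safe
    fix \<omega> assume "\<epsilon> / 2 < spectral_norm (sample_average s B \<omega> - B)"
    then obtain w where w: "norm w = 1" "\<epsilon> / 2 \<le> w \<bullet> (dilation (sample_average s B \<omega> - B) *v w)"
      using \<open>0 < \<epsilon>\<close> spectral_norm_less_imp_dilation[of "\<epsilon> / 2" "sample_average s B \<omega> - B"]
      by (metis less_imp_le half_gt_zero)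
    have sum: "(\<Sum>t<s. X (\<omega> t)) = \<theta> *\<^sub>R dilation (\<Sum>t<s. sample B (\<omega> t) - B)"
      by (simp add: X_def dilation_sum scaleR_sum_right)
    have "(\<Sum>t<s. sample B (\<omega> t) - B) = real s *\<^sub>R (sample_average s B \<omega> - B)"
      using \<open>0 < s\<close> by (simp add: sample_average_eq sum_subtractf scaleR_diff_right sum_constant_scaleR
          del: sum_constant)
    then have "w \<bullet> ((\<Sum>t<s. X (\<omega> t)) *v w)
        = \<theta> * (real s * (w \<bullet> (dilation (sample_average s B \<omega> - B) *v w)))"
      by (simp add: sum scaleR_matrix_vector_assoc[symmetric] inner_dilation_mult)
    then have "\<tau> \<le> w \<bullet> ((\<Sum>t<s. X (\<omega> t)) *v w)"
      using w(2) \<theta> by (simp add: \<tau>_def mult_left_mono)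
    with w(1) show "\<exists>w. norm w = 1 \<and> \<tau> \<le> w \<bullet> ((\<Sum>t<s. X (\<omega> t)) *v w)" by blast
  qed
  have "measure_pmf.prob (Pi_pmf {..<s} d (\<lambda>_. entry_pmf B))
      {\<omega>. \<epsilon> / 2 < spectral_norm (sample_average s B \<omega> - B)}
    \<le> measure_pmf.prob (Pi_pmf {..<s} d (\<lambda>_. entry_pmf B))
      {\<omega>. \<exists>w. norm w = 1 \<and> \<tau> \<le> w \<bullet> ((\<Sum>t<s. X (\<omega> t)) *v w)}"
    by (rule measure_pmf.finite_measure_mono[OF event]) simp
  also have "\<dots> \<le> real CARD('n + 'n) * exp (real s * V * (exp 1 - 1 - 1) / 1\<^sup>2 - \<tau>)"
    by (rule matrix_bernstein[OF fin symX boundX _ meanX varX])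
      (use \<theta> \<open>0 < \<epsilon>\<close> in \<open>simp_all add: V_def \<tau>_def\<close>)
  also have "real s * V * (exp 1 - 1 - 1) / 1\<^sup>2 - \<tau>
      = - ((4 - exp 1) * (real s * \<epsilon>\<^sup>2 / (16 * ?n * (norm B)\<^sup>2)))"
  proof -
    define x where "x = real s * \<epsilon>\<^sup>2 / (16 * ?n * (norm B)\<^sup>2)"
    \<comment> \<open>With L = 1 the exponent is (e - 2) x - 2 x = - (4 - e) x.\<close>
    have eqs: "real s * V = x" "\<tau> = 2 * x"
      using n B by (simp_all add: x_def V_def \<tau>_def \<theta>_def power2_eq_square field_simps)
    show ?thesis unfolding eqs x_def[symmetric] by (simp add: algebra_simps)
  qed
  finally show ?thesis by simp
qed

section \<open>Truncation error and total error\<close>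

lemma spectral_norm_uminus: "spectral_norm (- A) = spectral_norm A" for A :: "real ^ 'n ^ 'm"
  using spectral_norm_scaleR[of "- 1" A] by simp

text \<open>There are n^2 entries, each changed by at most \<epsilon>/(2n).\<close>

lemma norm_diff_truncate_entries:
  fixes A :: "real ^ 'n ^ 'n"
  assumes "0 < \<epsilon>"
  shows "norm (A - truncate_entries \<epsilon> A) \<le> \<epsilon> / 2"
proof (rule power2_le_imp_le)
  let ?n = "real CARD('n)"
  have "((A - truncate_entries \<epsilon> A) $ i $ j)\<^sup>2 \<le> (\<epsilon> / (2 * ?n))\<^sup>2" for i j
    using assms by (auto simp: truncate_entries_def abs_le_square_iff[symmetric])
  then have "(norm (A - truncate_entries \<epsilon> A))\<^sup>2 \<le> (\<Sum>i\<in>(UNIV :: 'n set). \<Sum>j\<in>(UNIV :: 'n set). (\<epsilon> / (2 * ?n))\<^sup>2)"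
    unfolding norm_matrix_squared by (intro sum_mono)
  also have "\<dots> = (\<epsilon> / 2)\<^sup>2"
    by (simp add: power2_eq_square)
  finally show "(norm (A - truncate_entries \<epsilon> A))\<^sup>2 \<le> (\<epsilon> / 2)\<^sup>2" .
qed (use assms in simp)

lemma norm_truncate_entries_le: "norm (truncate_entries \<epsilon> A) \<le> norm A"
proof -
  have "(norm (truncate_entries \<epsilon> A))\<^sup>2 \<le> (norm A)\<^sup>2"
    unfolding norm_matrix_squared by (intro sum_mono) (simp add: truncate_entries_def)
  then show ?thesis by simp
qed

text \<open>Truncation and sampling each use half of \<epsilon>. The hypothesis on \<open>s\<close>
  is an inequality so that the number of samples may be rounded up.\<close>

lemma spectral_norm_sparsify_tail:
  fixes A :: "real ^ 'n ^ 'n"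
  assumes "0 < \<epsilon>"
    and s: "28 * real CARD('n) * ln (sqrt 2 * real CARD('n)) / \<epsilon>\<^sup>2 * (frobenius_norm A)\<^sup>2 \<le> real s"
  shows "1 - 1 / real CARD('n) \<le> measure_pmf.prob (sparsify \<epsilon> s A) {A'. spectral_norm (A - A') \<le> \<epsilon>}"
proof (cases "truncate_entries \<epsilon> A = 0")
  case True
  then have "spectral_norm (A - 0) \<le> \<epsilon>"
    using norm_diff_truncate_entries[OF assms(1), of A] spectral_norm_le_norm[of A] assms(1) by simp
  then show ?thesis
    by (simp add: sparsify_def True Let_def measure_return_pmf)
next
  case False
  define B where "B = truncate_entries \<epsilon> A"
  let ?n = "real CARD('n)" and ?P = "Pi_pmf {..<s} undefined (\<lambda>_. entry_pmf B)"
  let ?E = "{\<omega>. \<epsilon> / 2 < spectral_norm (sample_average s B \<omega> - B)}"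
  let ?l = "ln (sqrt 2 * ?n)"
  have B0: "B \<noteq> 0" using False by (simp add: B_def)
  have n: "1 \<le> ?n" by simp
  \<comment> \<open>The factor sqrt 2 keeps the logarithm positive even for n = 1, which forces
    \<open>s\<close> to be positive.\<close>
  have "1 < sqrt 2 * ?n"
    using mult_left_mono[OF n, of "sqrt 2"] real_sqrt_gt_1_iff[of 2] by linarith
  then have l: "0 < ?l" by simp
  have BA: "(norm B)\<^sup>2 \<le> (norm A)\<^sup>2"
    using norm_truncate_entries_le[of \<epsilon> A] by (simp add: B_def)
  have NB: "0 < (norm B)\<^sup>2" using B0 by simp
  have s1: "28 * ?n * ?l / \<epsilon>\<^sup>2 * (norm B)\<^sup>2 \<le> real s"
  proof -
    have "28 * ?n * ?l / \<epsilon>\<^sup>2 * (norm B)\<^sup>2 \<le> 28 * ?n * ?l / \<epsilon>\<^sup>2 * (norm A)\<^sup>2"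
      using BA l by (intro mult_left_mono) auto
    then show ?thesis using s by (simp add: norm_matrix)
  qed
  have "0 < 28 * ?n * ?l / \<epsilon>\<^sup>2 * (norm B)\<^sup>2"
    using l NB n assms(1) by simp
  then have s0: "0 < s" using s1 by (metis less_le_trans of_nat_0_less_iff)
  have "measure_pmf.prob ?P ?E \<le> 2 * ?n * exp (- ((4 - exp 1) * (real s * \<epsilon>\<^sup>2 / (16 * ?n * (norm B)\<^sup>2))))"
    by (rule sample_average_tail[OF B0 assms(1) s0]) (auto simp: B_def truncate_entries_def split: if_splits)
  also have "\<dots> \<le> 2 * ?n * exp (- (2 * ?l))"
  proof -
    \<comment> \<open>Since 4 - e > 1.28 > 8/7, the decay rate is at least (8/7) (28/16) l = 2 l for
      l = ln (sqrt 2 n). As exp (- 2 l) = 1 / (2 n^2), the prefactor 2 n leaves 1 / n.\<close>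
    have "28 / 16 * ?l \<le> real s * \<epsilon>\<^sup>2 / (16 * ?n * (norm B)\<^sup>2)"
      using s1 assms(1) n NB by (simp add: field_simps)
    then have "(8 / 7) * (28 / 16 * ?l) \<le> (4 - exp 1) * (real s * \<epsilon>\<^sup>2 / (16 * ?n * (norm B)\<^sup>2))"
      using e_less_272 l by (intro mult_mono) auto
    then show ?thesis by simp
  qed
  also have "\<dots> = 1 / ?n"
  proof -
    have "exp (- (2 * ?l)) = 1 / (sqrt 2 * ?n)\<^sup>2"
      using \<open>1 < sqrt 2 * ?n\<close> by (simp add: exp_minus exp_double field_simps)
    also have "\<dots> = 1 / (2 * ?n * ?n)"
      by (simp add: power_mult_distrib power2_eq_square[of ?n] mult.assoc)
    finally show ?thesis by simp
  qed
  finally have tail: "measure_pmf.prob ?P ?E \<le> 1 / ?n" .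
  have "- ?E \<subseteq> sample_average s B -` {A'. spectral_norm (A - A') \<le> \<epsilon>}"
  proof
    fix \<omega> assume "\<omega> \<in> - ?E"
    then have "spectral_norm (B - sample_average s B \<omega>) \<le> \<epsilon> / 2"
      using spectral_norm_uminus[of "B - sample_average s B \<omega>"] by simp
    moreover have "spectral_norm (A - B) \<le> \<epsilon> / 2"
      using norm_diff_truncate_entries[OF assms(1), of A] spectral_norm_le_norm[of "A - B"]
      by (simp add: B_def)
    ultimately show "\<omega> \<in> sample_average s B -` {A'. spectral_norm (A - A') \<le> \<epsilon>}"
      using spectral_norm_triangle[of "A - B" "B - sample_average s B \<omega>"] by simp
  qed
  then have "measure_pmf.prob ?P (- ?E) \<le> measure_pmf.prob ?P (sample_average s B -` {A'. spectral_norm (A - A') \<le> \<epsilon>})"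
    by (rule measure_pmf.finite_measure_mono) simp
  moreover have "measure_pmf.prob ?P (- ?E) = 1 - measure_pmf.prob ?P ?E"
    using measure_pmf.prob_compl[of ?E ?P] by (simp add: Compl_eq_Diff_UNIV)
  moreover have "sparsify \<epsilon> s A = map_pmf (sample_average s B) ?P"
    using B0 by (simp add: sparsify_def Let_def B_def)
  ultimately show ?thesis using tail by simp
qed

lemma nonzero_entries_sample_average: "nonzero_entries (sample_average s B \<omega>) \<subseteq> \<omega> ` {..<s}"
proof
  fix x assume "x \<in> nonzero_entries (sample_average s B \<omega>)"
  then obtain i j where x: "x = (i, j)" and "(\<Sum>t<s. sample B (\<omega> t) $ i $ j) \<noteq> 0"
    by (auto simp: nonzero_entries_def sample_average_eq)
  then obtain t where "t < s" "sample B (\<omega> t) $ i $ j \<noteq> 0"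
    by (meson lessThan_iff sum.not_neutral_contains_not_neutral)
  then show "x \<in> \<omega> ` {..<s}"
    using x by (force simp: sample_def matrix_unit_nth split: prod.splits if_splits)
qed

lemma card_nonzero_entries_sparsify:
  assumes "A' \<in> set_pmf (sparsify \<epsilon> s A)"
  shows "card (nonzero_entries A') \<le> s"
proof (cases "truncate_entries \<epsilon> A = 0")
  case True
  then have "nonzero_entries A' = {}" using assms by (simp add: sparsify_def nonzero_entries_def)
  then show ?thesis by simp
next
  case False
  then obtain \<omega> where A': "A' = sample_average s (truncate_entries \<epsilon> A) \<omega>"
    using assms by (auto simp: sparsify_def Let_def)
  have "card (nonzero_entries A') \<le> card (\<omega> ` {..<s})"
    unfolding A' by (intro card_mono nonzero_entries_sample_average) simp
  also have "\<dots> \<le> s" using card_image_le[of "{..<s}" \<omega>] by simp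
  finally show ?thesis .
qed

subsection \<open>One-pass implementation\<close>

text \<open>The registers \<open>0, \<dots>, s - 1\<close> hold the values of the sampled entries, register \<open>s\<close> the sum of
  squares so far and register \<open>s + 1\<close> the current entry.\<close>

primrec resample :: "nat \<Rightarrow> nat \<Rightarrow> prog" where
  "resample s 0 = Skip"
| "resample s (Suc r) = Seq (resample s r)
     (Flip (Divide (Times (Reg (Suc s)) (Reg (Suc s))) (Reg s)) (Seq (Load_Value r) (Load_Position r)) Skip)"

text \<open>The nested comparisons test whether the absolute value is below \<delta>; both are
  strict, as in \<open>truncate_entries\<close>, so boundary values are kept. The entry is first
  loaded into a register because expressions can only refer to registers.\<close>

definition reservoir_sampling :: "nat \<Rightarrow> real \<Rightarrow> prog" where
  "reservoir_sampling s \<delta> = (let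
       update = Seq (Assign s (Plus (Reg s) (Times (Reg (Suc s)) (Reg (Suc s))))) (resample s s)
     in Seq (Load_Value (Suc s))
       (If_Less (Const (- \<delta>)) (Reg (Suc s)) (If_Less (Reg (Suc s)) (Const \<delta>) Skip update) update))"

text \<open>For an entry b with p = b^2 / F, where F is the final sum of squares, the summand (1/s)
  (b / p) equals F / (s b).\<close>

definition reservoir_output :: "nat \<Rightarrow> (nat \<times> rexp) list" where
  "reservoir_output s = map (\<lambda>k. (k, Divide (Reg s) (Times (Const (real s)) (Reg k)))) [0..<s]"

text \<open>\<open>s\<close> values, \<open>s\<close> positions of two words each, the running sum
  and the current entry.\<close>

lemma memory_words_reservoir_sampling: "memory_words (reservoir_sampling s \<delta>) \<le> 3 * s + 2"
proof -
  have regs: "written_regs (resample s r) = {..<r}" for r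
    by (induction r) (simp_all add: lessThan_Suc)
  have positions: "written_positions (resample s r) = {..<r}" for r
    by (induction r) (simp_all add: lessThan_Suc)
  have "written_regs (reservoir_sampling s \<delta>) = {..<Suc (Suc s)}"
    by (simp add: reservoir_sampling_def Let_def regs lessThan_Suc insert_commute)
  moreover have "written_positions (reservoir_sampling s \<delta>) = {..<s}"
    by (simp add: reservoir_sampling_def Let_def positions)
  ultimately show ?thesis by (simp add: memory_words_def)
qed

text \<open>The probability is computed from registers \<open>s\<close> and \<open>s + 1\<close>,
  which the loop never overwrites. All coins therefore have the same bias and are
  independent.\<close>

lemma exec_resample:
  assumes "r \<le> s" "fst \<sigma> (Suc s) = a"
  shows "exec (resample s r) ij a \<sigma> =
    map_pmf (\<lambda>b. (\<lambda>k. if b k then a else fst \<sigma> k, \<lambda>k. if b k then Some ij else snd \<sigma> k))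
      (Pi_pmf {..<r} False (\<lambda>_. bernoulli_pmf (a\<^sup>2 / fst \<sigma> s)))"
  using assms(1)
proof (induction r)
  case 0
  then show ?case by simp
next
  case (Suc r)
  let ?p = "bernoulli_pmf (a\<^sup>2 / fst \<sigma> s)"
  let ?m = "\<lambda>b. (\<lambda>k. if b k then a else fst \<sigma> k, \<lambda>k. if b k then Some ij else snd \<sigma> k)"
  let ?flip = "Flip (Divide (Times (Reg (Suc s)) (Reg (Suc s))) (Reg s)) (Seq (Load_Value r) (Load_Position r)) Skip"
  have flip: "exec ?flip ij a (?m b) = map_pmf (\<lambda>c. ?m (b(r := c))) ?p"
    if "b \<in> set_pmf (Pi_pmf {..<r} False (\<lambda>_. ?p))" for b
  proof -
    \<comment> \<open>Coins outside \<open>{..<r}\<close> have the default \<open>False\<close>: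
      cell \<open>r\<close> is still untouched, and so are the registers \<open>s\<close> and
      \<open>s + 1\<close>.\<close>
    have b: "\<not> b k" if "r \<le> k" for k
      using \<open>b \<in> _\<close> that set_Pi_pmf_subset[of "{..<r}" False "\<lambda>_. ?p"] by auto
    have regs: "fst (?m b) s = fst \<sigma> s" "fst (?m b) (Suc s) = a"
      using b Suc.prems assms(2) by simp_all
    have heads: "((fst (?m b))(r := a), (snd (?m b))(r := Some ij)) = ?m (b(r := True))"
      by (auto simp: fun_eq_iff)
    have tails: "?m b = ?m (b(r := False))"
      using b[of r] by (auto simp: fun_eq_iff)
    have "exec ?flip ij a \<rho> = bind_pmf (bernoulli_pmf (fst \<rho> (Suc s) * fst \<rho> (Suc s) / fst \<rho> s))
        (\<lambda>c. if c then return_pmf ((fst \<rho>)(r := a), (snd \<rho>)(r := Some ij)) else return_pmf \<rho>)" for \<rho>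
      by (simp add: bind_return_pmf cong: if_cong)
    from this[of "?m b"] have "exec ?flip ij a (?m b) = bind_pmf (bernoulli_pmf (fst (?m b) (Suc s) * fst (?m b) (Suc s) / fst (?m b) s))
        (\<lambda>c. if c then return_pmf ((fst (?m b))(r := a), (snd (?m b))(r := Some ij)) else return_pmf (?m b))" .
    also have "\<dots> = bind_pmf ?p
        (\<lambda>c. if c then return_pmf ((fst (?m b))(r := a), (snd (?m b))(r := Some ij)) else return_pmf (?m b))"
      by (simp only: regs power2_eq_square)
    also have "\<dots> = map_pmf (\<lambda>c. ?m (b(r := c))) ?p"
      unfolding map_pmf_def
    proof (rule bind_pmf_cong[OF refl])
      fix c
      show "(if c then return_pmf ((fst (?m b))(r := a), (snd (?m b))(r := Some ij)) else return_pmf (?m b))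
          = return_pmf (?m (b(r := c)))"
      proof (cases c)
        case True
        then have "c = True" by simp
        then show ?thesis by (simp only: heads if_True)
      next
        case False
        then have "c = False" by simp
        then show ?thesis by (simp only: if_False) (rule arg_cong[OF tails])
      qed
    qed
    finally show ?thesis .
  qed
  have "exec (resample s (Suc r)) ij a \<sigma> = bind_pmf (Pi_pmf {..<r} False (\<lambda>_. ?p)) (\<lambda>b. exec ?flip ij a (?m b))"
    using Suc by (simp add: bind_map_pmf del: exec.simps(7))
  also have "\<dots> = bind_pmf (Pi_pmf {..<r} False (\<lambda>_. ?p)) (\<lambda>b. map_pmf (\<lambda>c. ?m (b(r := c))) ?p)"
    by (intro bind_pmf_cong refl flip)
  also have "\<dots> = map_pmf ?m (Pi_pmf {..<Suc r} False (\<lambda>_. ?p))"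
    by (simp add: Pi_pmf_lessThan_Suc map_bind_pmf pmf.map_comp o_def)
  finally show ?case .
qed

text \<open>The form of the memory between two entries of the stream. The value registers are
  functions of the stored positions \<open>f\<close>, which carry all the randomness;
  \<open>c\<close> is the sum of squares and \<open>a\<close> the entry read last.\<close>

definition reservoir_memory ::
    "nat \<Rightarrow> real ^ 'n ^ 'n \<Rightarrow> real \<Rightarrow> real \<Rightarrow> (nat \<Rightarrow> ('n \<times> 'n) option) \<Rightarrow> 'n memory" where
  "reservoir_memory s A c a f =
     (\<lambda>k. if k < s then (case f k of None \<Rightarrow> 0 | Some (i, j) \<Rightarrow> A $ i $ j)
        else if k = s then c else if k = Suc s then a else 0, f)"

lemma exec_reservoir_sampling:
  fixes A :: "real ^ 'n ^ 'n" and i j :: 'n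
  assumes "0 < \<epsilon>"
  defines "b \<equiv> truncate_entries \<epsilon> A $ i $ j"
  shows "exec (reservoir_sampling s (\<epsilon> / (2 * real CARD('n)))) (i, j) (A $ i $ j) (reservoir_memory s A c a f) =
    map_pmf (\<lambda>h. reservoir_memory s A (c + b\<^sup>2) (A $ i $ j) (\<lambda>k. if h k then Some (i, j) else f k))
      (Pi_pmf {..<s} False (\<lambda>_. bernoulli_pmf (b\<^sup>2 / (c + b\<^sup>2))))"
proof -
  let ?a = "A $ i $ j" and ?\<delta> = "\<epsilon> / (2 * real CARD('n))"
  define upd where "upd = Seq (Assign s (Plus (Reg s) (Times (Reg (Suc s)) (Reg (Suc s))))) (resample s s)"
  have load: "exec (reservoir_sampling s ?\<delta>) (i, j) ?a (reservoir_memory s A c a f)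
      = (if \<bar>?a\<bar> < ?\<delta> then return_pmf (reservoir_memory s A c ?a f)
         else exec upd (i, j) ?a (reservoir_memory s A c ?a f))"
  proof -
    have "((fst (reservoir_memory s A c a f))(Suc s := ?a), snd (reservoir_memory s A c a f)) = reservoir_memory s A c ?a f"
      by (auto simp: reservoir_memory_def fun_eq_iff)
    moreover have "fst (reservoir_memory s A c ?a f) (Suc s) = ?a"
      by (simp add: reservoir_memory_def)
    ultimately show ?thesis
      by (auto simp: reservoir_sampling_def Let_def bind_return_pmf abs_less_iff upd_def[symmetric])
  qed
  show ?thesis
  proof (cases "\<bar>?a\<bar> < ?\<delta>")
    case True
    then have "b = 0" by (simp add: b_def truncate_entries_def)
    \<comment> \<open>A discarded entry makes the bias zero, also for c = 0 by 0 / 0 = 0. Discarded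
      and kept entries thus obey the same formula.\<close>
    moreover have "bernoulli_pmf 0 = return_pmf False"
    proof (rule pmf_eqI)
      show "pmf (bernoulli_pmf 0) x = pmf (return_pmf False) x" for x by (cases x) simp_all
    qed
    ultimately show ?thesis using True by (simp add: load)
  next
    case False
    then have b: "b = ?a" by (simp add: b_def truncate_entries_def)
    have "exec upd (i, j) ?a (reservoir_memory s A c ?a f)
        = exec (resample s s) (i, j) ?a (reservoir_memory s A (c + ?a\<^sup>2) ?a f)"
    proof -
      have "((fst (reservoir_memory s A c ?a f))(s := c + ?a * ?a), snd (reservoir_memory s A c ?a f))
          = reservoir_memory s A (c + ?a\<^sup>2) ?a f"
        by (auto simp: reservoir_memory_def fun_eq_iff power2_eq_square)
      then show ?thesis
        by (simp add: upd_def bind_return_pmf) (simp add: reservoir_memory_def)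
    qed
    also have "\<dots> = map_pmf (\<lambda>h. reservoir_memory s A (c + b\<^sup>2) ?a (\<lambda>k. if h k then Some (i, j) else f k))
      (Pi_pmf {..<s} False (\<lambda>_. bernoulli_pmf (b\<^sup>2 / (c + b\<^sup>2))))"
    proof (subst exec_resample)
      show "fst (reservoir_memory s A (c + ?a\<^sup>2) ?a f) (Suc s) = ?a" by (simp add: reservoir_memory_def)
      have *: "fst (reservoir_memory s A (c + ?a\<^sup>2) ?a f) s = c + ?a\<^sup>2" by (simp add: reservoir_memory_def)
      show "map_pmf (\<lambda>h. (\<lambda>k. if h k then ?a else fst (reservoir_memory s A (c + ?a\<^sup>2) ?a f) k,
            \<lambda>k. if h k then Some (i, j) else snd (reservoir_memory s A (c + ?a\<^sup>2) ?a f) k))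
          (Pi_pmf {..<s} False (\<lambda>_. bernoulli_pmf (?a\<^sup>2 / fst (reservoir_memory s A (c + ?a\<^sup>2) ?a f) s)))
        = map_pmf (\<lambda>h. reservoir_memory s A (c + b\<^sup>2) ?a (\<lambda>k. if h k then Some (i, j) else f k))
          (Pi_pmf {..<s} False (\<lambda>_. bernoulli_pmf (b\<^sup>2 / (c + b\<^sup>2))))"
        unfolding b *
      proof (rule map_pmf_cong[OF refl])
        fix h assume "h \<in> set_pmf (Pi_pmf {..<s} False (\<lambda>_. bernoulli_pmf (?a\<^sup>2 / (c + ?a\<^sup>2))))"
        then have "\<not> h k" if "s \<le> k" for k
          using that set_Pi_pmf_subset[of "{..<s}" False "\<lambda>_. bernoulli_pmf (?a\<^sup>2 / (c + ?a\<^sup>2))"] by auto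
        then show "(\<lambda>k. if h k then ?a else fst (reservoir_memory s A (c + ?a\<^sup>2) ?a f) k,
            \<lambda>k. if h k then Some (i, j) else snd (reservoir_memory s A (c + ?a\<^sup>2) ?a f) k)
          = reservoir_memory s A (c + ?a\<^sup>2) ?a (\<lambda>k. if h k then Some (i, j) else f k)"
          by (auto simp: reservoir_memory_def fun_eq_iff)
      qed
    qed simp
    finally show ?thesis using False by (simp add: load)
  qed
qed

section \<open>Distribution of the memory after a prefix of the stream\<close>

lemma run_stream_append:
  "run_stream p A (xs @ ys) \<sigma> = bind_pmf (run_stream p A xs \<sigma>) (run_stream p A ys)"
proof (induction xs arbitrary: \<sigma>)
  case (Cons x xs)
  then have "run_stream p A (xs @ ys) = (\<lambda>\<sigma>. bind_pmf (run_stream p A xs \<sigma>) (run_stream p A ys))"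
    by (rule ext)
  then show ?case by (simp add: bind_assoc_pmf)
qed (simp add: bind_return_pmf)

text \<open>\<open>run_stream\<close> recurses from the front, whereas the invariant grows at the
  back.\<close>

lemma run_stream_snoc:
  "run_stream p A (xs @ [x]) \<sigma> = bind_pmf (run_stream p A xs \<sigma>) (exec p x (A $ fst x $ snd x))"
proof -
  have "run_stream p A [] = return_pmf" by (rule ext) simp
  then have "run_stream p A [x] = exec p x (A $ fst x $ snd x)"
    by (intro ext) (simp add: bind_return_pmf')
  then show ?thesis by (simp only: run_stream_append)
qed

text \<open>Used with \<open>S\<close> the set of positions read so far.\<close>

definition restrict_entries :: "('n \<times> 'n) set \<Rightarrow> real ^ 'n ^ 'n \<Rightarrow> real ^ 'n ^ 'n" where
  "restrict_entries S B = (\<chi> i j. if (i, j) \<in> S then B $ i $ j else 0)"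

lemma norm_restrict_entries: "(norm (restrict_entries S B))\<^sup>2 = (\<Sum>(i, j)\<in>S. (B $ i $ j)\<^sup>2)"
proof -
  have "(norm (restrict_entries S B))\<^sup>2 = (\<Sum>x\<in>UNIV. if x \<in> S then (case x of (i, j) \<Rightarrow> (B $ i $ j)\<^sup>2) else 0)"
    unfolding norm_matrix_squared sum_UNIV_prod
    by (intro sum.cong) (simp_all add: restrict_entries_def)
  then show ?thesis by (simp add: sum.If_cases)
qed

text \<open>The distribution of one reservoir cell when the entries kept so far form
  \<open>B\<close>; \<open>None\<close> means that nothing has been kept yet.\<close>

definition cell_pmf :: "real ^ 'n ^ 'n \<Rightarrow> ('n \<times> 'n) option pmf" where
  "cell_pmf B = (if B = 0 then return_pmf None else map_pmf Some (entry_pmf B))"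

lemma pmf_cell_pmf:
  "pmf (cell_pmf B) x = (case x of None \<Rightarrow> of_bool (B = 0) | Some y \<Rightarrow> entry_prob B y)"
proof (cases "B = 0")
  case True
  then show ?thesis
    by (auto simp: cell_pmf_def entry_prob_def indicator_def split: option.split)
next
  case False
  then have "pmf (map_pmf Some (entry_pmf B)) None = 0"
    by (simp add: pmf_eq_0_set_pmf)
  with False show ?thesis
    by (auto simp: cell_pmf_def pmf_map_inj' pmf_entry_pmf split: option.split)
qed

text \<open>The reservoir step: the new position receives probability q, and every old probability
  is multiplied by 1 - q, the quotient of the old and the new sum of squares, which replaces the old
  denominator by the new one.\<close>

lemma cell_pmf_insert:
  fixes B :: "real ^ 'n ^ 'n"
  fixes i j :: 'n
  assumes "(i, j) \<notin> S"
  defines "q \<equiv> (B $ i $ j)\<^sup>2 / (norm (restrict_entries (insert (i, j) S) B))\<^sup>2"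
  shows "cell_pmf (restrict_entries (insert (i, j) S) B)
    = bind_pmf (cell_pmf (restrict_entries S B)) (\<lambda>x. map_pmf (\<lambda>h. if h then Some (i, j) else x) (bernoulli_pmf q))"
proof (rule pmf_eqI)
  fix x
  let ?C = "restrict_entries S B" and ?C' = "restrict_entries (insert (i, j) S) B"
  have C': "(norm ?C')\<^sup>2 = (norm ?C)\<^sup>2 + (B $ i $ j)\<^sup>2"
    using assms(1) by (simp add: norm_restrict_entries)
  have q: "0 \<le> q" "q \<le> 1" using zero_le_power2[of "norm ?C"]
    by (simp_all add: q_def C' divide_le_eq_1 add_nonneg_pos less_le)
  \<comment> \<open>Flipping the coin first shows the update as a mixture of the new position and
    the old cell.\<close>
  have "bind_pmf (cell_pmf ?C) (\<lambda>x. map_pmf (\<lambda>h. if h then Some (i, j) else x) (bernoulli_pmf q))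
      = bind_pmf (bernoulli_pmf q) (\<lambda>h. if h then return_pmf (Some (i, j)) else cell_pmf ?C)"
    unfolding map_pmf_def
    by (subst bind_commute_pmf) (auto intro!: bind_pmf_cong simp: bind_return_pmf')
  then have rhs: "pmf (bind_pmf (cell_pmf ?C) (\<lambda>x. map_pmf (\<lambda>h. if h then Some (i, j) else x) (bernoulli_pmf q))) x
      = of_bool (x = Some (i, j)) * q + pmf (cell_pmf ?C) x * (1 - q)"
    using q by (simp add: pmf_bind indicator_def)
  have zero: "Z = 0 \<longleftrightarrow> (norm Z)\<^sup>2 = 0" for Z :: "real ^ 'n ^ 'n" by simp
  show "pmf (cell_pmf ?C') x = pmf (bind_pmf (cell_pmf ?C) (\<lambda>x. map_pmf (\<lambda>h. if h then Some (i, j) else x) (bernoulli_pmf q))) x"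
  proof (cases "?C' = 0")
    case True
    then have "(norm ?C)\<^sup>2 = 0" "q = 0" using C' by (simp_all add: q_def add_nonneg_eq_0_iff)
    then show ?thesis unfolding rhs using True by simp
  next
    case False
    then have N: "0 < (norm ?C')\<^sup>2" by simp
    have q': "1 - q = (norm ?C)\<^sup>2 / (norm ?C')\<^sup>2"
    proof -
      have "1 - v / d = (d - v) / d" if "d \<noteq> 0" for v d :: real
        using that by (simp add: diff_divide_distrib)
      moreover have "(norm ?C')\<^sup>2 \<noteq> 0" using N by linarith
      ultimately have "1 - q = ((norm ?C')\<^sup>2 - (B $ i $ j)\<^sup>2) / (norm ?C')\<^sup>2"
        unfolding q_def by blast
      also have "(norm ?C')\<^sup>2 - (B $ i $ j)\<^sup>2 = (norm ?C)\<^sup>2"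
        using C' by linarith
      finally show ?thesis .
    qed
    show ?thesis
    proof (cases x)
      case None
      then show ?thesis unfolding rhs q' using False by (simp add: pmf_cell_pmf)
    next
      case (Some y)
      obtain k l where y: "y = (k, l)" by fastforce
      have "entry_prob ?C' (k, l) = of_bool ((k, l) = (i, j)) * q + entry_prob ?C (k, l) * ((norm ?C)\<^sup>2 / (norm ?C')\<^sup>2)"
      \<comment> \<open>If \<open>?C = 0\<close>, the new entry is the first nonzero one, and q =
        1.\<close>
      proof (cases "?C = 0")
        case True
        then have "?C $ k $ l = 0" by simp
        then show ?thesis using True assms(1)
          by (auto simp: entry_prob_def q_def norm_matrix[symmetric] restrict_entries_def split: if_splits)
      next
        case False
        then show ?thesis using assms(1)
          by (auto simp: entry_prob_def q_def norm_matrix[symmetric] restrict_entries_def)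
      qed
      then show ?thesis unfolding rhs q' by (simp add: pmf_cell_pmf Some y)
    qed
  qed
qed

text \<open>The cells stay independent although they share the running sum, because that sum is
  determined by the entries read and each cell has its own coin.\<close>

lemma run_stream_reservoir_sampling:
  fixes A :: "real ^ 'n ^ 'n"
  assumes "0 < \<epsilon>" "distinct ijs"
  defines "C \<equiv> restrict_entries (set ijs) (truncate_entries \<epsilon> A)"
  shows "\<exists>a. run_stream (reservoir_sampling s (\<epsilon> / (2 * real CARD('n)))) A ijs (\<lambda>_. 0, \<lambda>_. None)
    = map_pmf (reservoir_memory s A ((norm C)\<^sup>2) a) (Pi_pmf {..<s} None (\<lambda>_. cell_pmf C))"
  using assms(2) unfolding C_def
proof (induction ijs rule: rev_induct)
  case Nil
  have "restrict_entries {} B = 0" for B :: "real ^ 'n ^ 'n"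
    by (simp add: vec_eq_iff restrict_entries_def)
  then show ?case
    by (intro exI[of _ 0]) (simp add: cell_pmf_def reservoir_memory_def fun_eq_iff)
next
  case (snoc ij ijs)
  obtain i j where ij: "ij = (i, j)" by fastforce
  let ?B = "truncate_entries \<epsilon> A" and ?p = "reservoir_sampling s (\<epsilon> / (2 * real CARD('n)))"
  let ?C = "restrict_entries (set ijs) ?B" and ?C' = "restrict_entries (set (ijs @ [ij])) ?B"
  obtain a where a: "run_stream ?p A ijs (\<lambda>_. 0, \<lambda>_. None)
      = map_pmf (reservoir_memory s A ((norm ?C)\<^sup>2) a) (Pi_pmf {..<s} None (\<lambda>_. cell_pmf ?C))"
    using snoc by auto
  have new: "(i, j) \<notin> set ijs" using snoc.prems by (simp add: ij)
  have C': "(norm ?C)\<^sup>2 + (?B $ i $ j)\<^sup>2 = (norm ?C')\<^sup>2"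
    using new by (simp add: norm_restrict_entries ij)
  let ?q = "(?B $ i $ j)\<^sup>2 / (norm ?C')\<^sup>2"
  have "run_stream ?p A (ijs @ [ij]) (\<lambda>_. 0, \<lambda>_. None)
      = bind_pmf (Pi_pmf {..<s} None (\<lambda>_. cell_pmf ?C)) (\<lambda>f.
          exec ?p (i, j) (A $ i $ j) (reservoir_memory s A ((norm ?C)\<^sup>2) a f))"
    by (simp add: run_stream_snoc a bind_map_pmf ij)
  also have "\<dots> = bind_pmf (Pi_pmf {..<s} None (\<lambda>_. cell_pmf ?C)) (\<lambda>f.
      map_pmf (\<lambda>h. reservoir_memory s A ((norm ?C')\<^sup>2) (A $ i $ j) (\<lambda>k. if h k then Some (i, j) else f k))
      (Pi_pmf {..<s} False (\<lambda>_. bernoulli_pmf ?q)))"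
    by (simp only: exec_reservoir_sampling[OF assms(1)] C')
  also have "\<dots> = map_pmf (reservoir_memory s A ((norm ?C')\<^sup>2) (A $ i $ j))
      (bind_pmf (Pi_pmf {..<s} None (\<lambda>_. cell_pmf ?C)) (\<lambda>f.
        map_pmf (\<lambda>h k. if h k then Some (i, j) else f k) (Pi_pmf {..<s} False (\<lambda>_. bernoulli_pmf ?q))))"
    by (simp add: map_bind_pmf pmf.map_comp o_def)
  \<comment> \<open>For fixed \<open>f\<close> the overwriting acts on each coordinate separately.
    Outside \<open>{..<s}\<close> the defaults agree: a coin \<open>False\<close> leaves the cell
    \<open>None\<close>.\<close>
  also have "bind_pmf (Pi_pmf {..<s} None (\<lambda>_. cell_pmf ?C)) (\<lambda>f.
        map_pmf (\<lambda>h k. if h k then Some (i, j) else f k) (Pi_pmf {..<s} False (\<lambda>_. bernoulli_pmf ?q)))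
      = bind_pmf (Pi_pmf {..<s} None (\<lambda>_. cell_pmf ?C)) (\<lambda>f.
        Pi_pmf {..<s} None (\<lambda>k. map_pmf (\<lambda>h. if h then Some (i, j) else f k) (bernoulli_pmf ?q)))"
  proof (rule bind_pmf_cong[OF refl])
    fix f assume "f \<in> set_pmf (Pi_pmf {..<s} None (\<lambda>_. cell_pmf ?C))"
    then have f: "f k = None" if "k \<notin> {..<s}" for k
      using that set_Pi_pmf_subset[of "{..<s}" None "\<lambda>_. cell_pmf ?C"] by auto
    show "map_pmf (\<lambda>h k. if h k then Some (i, j) else f k) (Pi_pmf {..<s} False (\<lambda>_. bernoulli_pmf ?q))
      = Pi_pmf {..<s} None (\<lambda>k. map_pmf (\<lambda>h. if h then Some (i, j) else f k) (bernoulli_pmf ?q))"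
      unfolding map_pmf_def[of _ "bernoulli_pmf ?q"]
      by (subst Pi_pmf_bind[where d' = False], simp, unfold map_pmf_def, rule bind_pmf_cong[OF refl])
        (use f set_Pi_pmf_subset[of "{..<s}" False "\<lambda>_. bernoulli_pmf ?q"] in \<open>auto simp: fun_eq_iff\<close>)
  qed
  also have "\<dots> = Pi_pmf {..<s} None (\<lambda>_. cell_pmf ?C')"
    using cell_pmf_insert[OF new, of ?B] by (simp add: ij Pi_pmf_bind[where d' = None])
  finally show ?case by blast
qed

section \<open>Output of the program\<close>

lemma read_off_reservoir_memory:
  fixes A :: "real ^ 'n ^ 'n"
  assumes "\<And>k. k < s \<Longrightarrow> f k = Some (\<omega> k)" and "\<And>k. k < s \<Longrightarrow> \<omega> k \<in> nonzero_entries (truncate_entries \<epsilon> A)"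
  shows "read_off (reservoir_output s) (reservoir_memory s A ((norm (truncate_entries \<epsilon> A))\<^sup>2) a f)
    = sample_average s (truncate_entries \<epsilon> A) \<omega>"
proof -
  let ?B = "truncate_entries \<epsilon> A"
  have "(case f k of None \<Rightarrow> 0 | Some (i, j) \<Rightarrow>
      ((norm ?B)\<^sup>2 / (real s * (case f k of None \<Rightarrow> 0 | Some (i, j) \<Rightarrow> A $ i $ j))) *\<^sub>R matrix_unit i j)
    = (1 / real s) *\<^sub>R sample ?B (\<omega> k)" if "k < s" for k
  proof -
    obtain i j where ij: "\<omega> k = (i, j)" by fastforce
    have nz: "?B $ i $ j \<noteq> 0" using assms(2)[OF that] by (simp add: ij nonzero_entries_def)
    \<comment> \<open>The registers hold entries of A; a sampled position is one where truncation
      changes nothing.\<close>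
    then have "A $ i $ j = ?B $ i $ j" by (auto simp: truncate_entries_def)
    then show ?thesis
      using nz by (simp add: assms(1)[OF that] ij sample_def entry_prob_def norm_matrix[symmetric] power2_eq_square)
  qed
  then have "(\<Sum>k<s. case f k of None \<Rightarrow> 0 | Some (i, j) \<Rightarrow>
      ((norm ?B)\<^sup>2 / (real s * (case f k of None \<Rightarrow> 0 | Some (i, j) \<Rightarrow> A $ i $ j))) *\<^sub>R matrix_unit i j)
    = sample_average s ?B \<omega>"
    unfolding sample_average_eq scaleR_sum_right by (intro sum.cong refl) simp
  moreover have "read_off (reservoir_output s) (reservoir_memory s A ((norm ?B)\<^sup>2) a f)
    = (\<Sum>k<s. case f k of None \<Rightarrow> 0 | Some (i, j) \<Rightarrow>
      ((norm ?B)\<^sup>2 / (real s * (case f k of None \<Rightarrow> 0 | Some (i, j) \<Rightarrow> A $ i $ j))) *\<^sub>R matrix_unit i j)"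
    unfolding read_off_def reservoir_output_def
    by (simp add: o_def interv_sum_list_conv_sum_set_nat atLeast0LessThan)
      (auto intro!: sum.cong simp: reservoir_memory_def split: option.split)
  ultimately show ?thesis by simp
qed

lemma one_pass_implementable_sparsify:
  assumes "0 < \<epsilon>"
  shows "one_pass_implementable (3 * s + 2) (sparsify \<epsilon> s :: real ^ 'n ^ 'n \<Rightarrow> (real ^ 'n ^ 'n) pmf)"
  unfolding one_pass_implementable_def
proof (intro exI conjI allI impI)
  let ?p = "reservoir_sampling s (\<epsilon> / (2 * real CARD('n)))"
  show "memory_words ?p \<le> 3 * s + 2" by (rule memory_words_reservoir_sampling)
  fix A :: "real ^ 'n ^ 'n" and ijs :: "('n \<times> 'n) list"
  assume ijs: "distinct ijs \<and> set ijs = UNIV"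
  let ?B = "truncate_entries \<epsilon> A"
  have "restrict_entries UNIV ?B = ?B" by (simp add: restrict_entries_def)
  then obtain a where "run_stream ?p A ijs (\<lambda>_. 0, \<lambda>_. None)
      = map_pmf (reservoir_memory s A ((norm ?B)\<^sup>2) a) (Pi_pmf {..<s} None (\<lambda>_. cell_pmf ?B))"
    using run_stream_reservoir_sampling[OF assms, of ijs s A] ijs by auto
  then have run: "map_pmf (read_off (reservoir_output s)) (run_stream ?p A ijs (\<lambda>_. 0, \<lambda>_. None))
      = map_pmf (\<lambda>f. read_off (reservoir_output s) (reservoir_memory s A ((norm ?B)\<^sup>2) a f))
          (Pi_pmf {..<s} None (\<lambda>_. cell_pmf ?B))"
    by (simp add: pmf.map_comp o_def)
  show "map_pmf (read_off (reservoir_output s)) (run_stream ?p A ijs (\<lambda>_. 0, \<lambda>_. None)) = sparsify \<epsilon> s A"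
  proof (cases "?B = 0")
    case True
    then show ?thesis unfolding run
      by (simp add: cell_pmf_def sparsify_def read_off_def reservoir_memory_def reservoir_output_def o_def
          interv_sum_list_conv_sum_set_nat)
  next
    case False
    \<comment> \<open>Mapping \<open>Some\<close> over the product in \<open>sparsify\<close> turns
      its default \<open>undefined\<close> into \<open>Some undefined\<close>, which is exchanged
      here for the \<open>None\<close> of unwritten cells.\<close>
    have "Pi_pmf {..<s} None (\<lambda>_. cell_pmf ?B)
        = map_pmf (\<lambda>f k. if k \<in> {..<s} then f k else None) (Pi_pmf {..<s} (Some undefined) (\<lambda>_. cell_pmf ?B))"
      by (rule Pi_pmf_default_swap[symmetric]) simp
    also have "Pi_pmf {..<s} (Some undefined) (\<lambda>_. cell_pmf ?B)
        = map_pmf (\<lambda>h. Some \<circ> h) (Pi_pmf {..<s} undefined (\<lambda>_. entry_pmf ?B))"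
      using False by (simp add: cell_pmf_def) (rule Pi_pmf_map, simp_all)
    finally have "map_pmf (\<lambda>f. read_off (reservoir_output s) (reservoir_memory s A ((norm ?B)\<^sup>2) a f))
          (Pi_pmf {..<s} None (\<lambda>_. cell_pmf ?B))
        = map_pmf (\<lambda>\<omega>. read_off (reservoir_output s) (reservoir_memory s A ((norm ?B)\<^sup>2) a
            (\<lambda>k. if k < s then Some (\<omega> k) else None))) (Pi_pmf {..<s} undefined (\<lambda>_. entry_pmf ?B))"
      by (simp add: pmf.map_comp o_def)
    also have "\<dots> = map_pmf (sample_average s ?B) (Pi_pmf {..<s} undefined (\<lambda>_. entry_pmf ?B))"
    proof (rule map_pmf_cong[OF refl], rule read_off_reservoir_memory)
      fix \<omega> k assume "\<omega> \<in> set_pmf (Pi_pmf {..<s} undefined (\<lambda>_. entry_pmf ?B))" "k < s"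
      then have "\<omega> k \<in> set_pmf (entry_pmf ?B)" by (auto simp: set_Pi_pmf PiE_dflt_def)
      then show "\<omega> k \<in> nonzero_entries ?B"
        using entry_prob_eq_0_iff[OF False]
        by (auto simp: set_pmf_iff pmf_entry_pmf[OF False] nonzero_entries_def split: prod.split)
    qed simp
    finally show ?thesis unfolding run using False by (simp add: sparsify_def Let_def)
  qed
qed

theorem theorem1:
  fixes A :: "real ^ 'n ^ 'n" and \<epsilon> :: real and s :: nat
  assumes "\<epsilon> > 0"
    and "s = nat \<lceil>28 * real CARD('n) * ln (sqrt 2 * real CARD('n)) / \<epsilon>\<^sup>2 * (frobenius_norm A)\<^sup>2\<rceil>"
  shows "measure_pmf.prob (sparsify \<epsilon> s A) {A'. spectral_norm (A - A') \<le> \<epsilon>} \<ge> 1 - 1 / real CARD('n)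
    \<and> (\<forall>A' \<in> set_pmf (sparsify \<epsilon> s A). card (nonzero_entries A') \<le> s)
    \<and> one_pass_implementable (3 * s + 2)
        (sparsify \<epsilon> s :: real ^ 'n ^ 'n \<Rightarrow> (real ^ 'n ^ 'n) pmf)"
proof (intro conjI ballI)
  show "measure_pmf.prob (sparsify \<epsilon> s A) {A'. spectral_norm (A - A') \<le> \<epsilon>} \<ge> 1 - 1 / real CARD('n)"
    \<comment> \<open>The ceiling only increases the number of samples.\<close>
    using assms(1) by (rule spectral_norm_sparsify_tail) (use assms(2) in linarith)
  show "one_pass_implementable (3 * s + 2) (sparsify \<epsilon> s :: real ^ 'n ^ 'n \<Rightarrow> (real ^ 'n ^ 'n) pmf)"
    using assms(1) by (rule one_pass_implementable_sparsify)
qed (rule card_nonzero_entries_sparsify)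

end
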